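(* Let $\alpha\in(0,1)$ and $\mu,\lambda_1,\beta_1>0$. Let $g_{\alpha,\mu}(x,t)$ be the probability density function of the tempered $\alpha$-stable subordinator, $f_G(y,t)$ the density of the gamma subordinator, and $f_M(x,t)$ the density of the tempered Mittag-Leffler Lévy process $M_{\alpha,\beta_1,\lambda_1,\mu}(t)$. Then for every $\tau\ge 1$, $f_M$ satisfies the fractional partial differential equation $$\frac{\partial^\tau}{\partial t^\tau} f_M(x,t)=\beta_1\frac{\partial^{\tau-1}}{\partial t^{\tau-1}}\left[(\log\lambda_1-\psi(\beta_1 t))\,f_M(x,t)+\int_0^\infty g_{\alpha,\mu}(x,y)\,(\log y)\,f_G(y,t)\,dy\right],\qquad x>0,\ t>0,$$ with $f_M(x,0)=0$. Here $\psi$ is the digamma function and $\partial^\tau/\partial t^\tau$ is the Riemann-Liouville fractional derivative in $t$.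
   Context: Gamma subordinator: $G_{\lambda_1,\beta_1}(t)$ is the gamma Lévy process with density $f_G(x,t)=\frac{\lambda_1^{\beta_1 t}}{\Gamma(\beta_1 t)}x^{\beta_1 t-1}e^{-\lambda_1 x}$, $x>0$, $t>0$; by convention $f_G(x,0)=0$ for $x>0$. Tempered $\alpha$-stable subordinator (TSS): $S_{\alpha,\mu}(t)$ is the subordinator with density $g_{\alpha,\mu}(x,t)=e^{-\mu x+\mu^\alpha t}g_\alpha(x,t)$, $x>0$, where $g_\alpha(\cdot,t)$ is the density of the $\alpha$-stable subordinator with Laplace transform $\int_0^\infty e^{-ux}g_\alpha(x,t)\,dx=e^{-tu^\alpha}$. Tempered Mittag-Leffler Lévy process (TMLLP): $M_{\alpha,\beta_1,\lambda_1,\mu}(t):=S_{\alpha,\mu}(G_{\lambda_1,\beta_1}(t))$, $t\ge0$, with $S_{\alpha,\mu}$ and $G_{\lambda_1,\beta_1}$ independent. Its density is $f_M(x,t)=\int_0^\infty g_{\alpha,\mu}(x,y)f_G(y,t)\,dy$, $x>0$. Riemann-Liouville fractional derivative (base point $0$, acting in $t$): for $n<\tau<n+1$ with $n\ge0$ an integer, $\frac{d^\tau}{dt^\tau}f(t)=\frac{1}{\Gamma(n+1-\tau)}\left(\frac{d}{dt}\right)^{n+1}\int_0^t(t-u)^{n-\tau}f(u)\,du$; for integer $\tau$ it is the ordinary derivative of order $\tau$ (the identity for $\tau=0$). *)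

theory Defs
  imports "HOL-Analysis.Analysis"
begin

text \<open>
  The density of the \<open>\<alpha>\<close>-stable subordinator at time \<open>t\<close> is determined by its Laplace transform
  up to a null set in \<open>x\<close>. Pointwise assertions in \<open>x\<close> refer to its continuous version, whence
  the continuity clause. The case \<open>u = 0\<close> says that the total mass is 1.
\<close>

definition stable_density :: "real \<Rightarrow> (real \<Rightarrow> real \<Rightarrow> real) \<Rightarrow> bool" where
  "stable_density \<alpha> g \<longleftrightarrow>
     (\<forall>t>0. (\<forall>x>0. g x t \<ge> 0) \<and>
            continuous_on {0<..} (\<lambda>x. g x t) \<and>
            (\<forall>u\<ge>0. set_integrable lborel {0<..} (\<lambda>x. exp (- u * x) * g x t) \<and>
                   (LBINT x:{0<..}. exp (- u * x) * g x t) = exp (- t * u powr \<alpha>)))"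

definition tempered_density :: "real \<Rightarrow> real \<Rightarrow> (real \<Rightarrow> real \<Rightarrow> real) \<Rightarrow> real \<Rightarrow> real \<Rightarrow> real" where
  "tempered_density \<alpha> \<mu> g x t = exp (- \<mu> * x + \<mu> powr \<alpha> * t) * g x t"

definition gamma_sub_density :: "real \<Rightarrow> real \<Rightarrow> real \<Rightarrow> real \<Rightarrow> real" where
  "gamma_sub_density lam\<^sub>1 \<beta>\<^sub>1 y t =
     (if t = 0 then 0
      else lam\<^sub>1 powr (\<beta>\<^sub>1 * t) / Gamma (\<beta>\<^sub>1 * t) * y powr (\<beta>\<^sub>1 * t - 1) * exp (- lam\<^sub>1 * y))"

text \<open>
  The density of the tempered stable subordinator evaluated at an independent gamma subordinator.
\<close>

definition tml_density ::
    "real \<Rightarrow> real \<Rightarrow> real \<Rightarrow> real \<Rightarrow> (real \<Rightarrow> real \<Rightarrow> real) \<Rightarrow> real \<Rightarrow> real \<Rightarrow> real" where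
  "tml_density \<alpha> \<beta>\<^sub>1 lam\<^sub>1 \<mu> g x t =
     (LBINT y:{0<..}. tempered_density \<alpha> \<mu> g x y * gamma_sub_density lam\<^sub>1 \<beta>\<^sub>1 y t)"

text \<open>
  Riemann--Liouville derivative of order \<open>\<tau> \<ge> 0\<close> with base point 0. Since \<open>deriv\<close> and the
  integral are total, the value is meaningful only under the existence predicate below.
\<close>

definition RL_kernel_integral :: "real \<Rightarrow> (real \<Rightarrow> real) \<Rightarrow> real \<Rightarrow> real" where
  "RL_kernel_integral \<tau> f t = (LBINT u:{0<..<t}. (t - u) powr (of_int \<lfloor>\<tau>\<rfloor> - \<tau>) * f u)"

definition RL_deriv :: "real \<Rightarrow> (real \<Rightarrow> real) \<Rightarrow> real \<Rightarrow> real" where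
  "RL_deriv \<tau> f t =
     (if \<tau> \<in> \<int> then (deriv ^^ nat \<lfloor>\<tau>\<rfloor>) f t
      else 1 / Gamma (of_int \<lfloor>\<tau>\<rfloor> + 1 - \<tau>) * (deriv ^^ (nat \<lfloor>\<tau>\<rfloor> + 1)) (RL_kernel_integral \<tau> f) t)"

definition times_differentiable_on :: "nat \<Rightarrow> (real \<Rightarrow> real) \<Rightarrow> real set \<Rightarrow> bool" where
  "times_differentiable_on n f S \<longleftrightarrow>
     (\<forall>k<n. \<forall>s\<in>S. (deriv ^^ k) f field_differentiable (at s))"

text \<open>The Riemann--Liouville derivative of order \<open>\<tau> \<ge> 0\<close> exists at every \<open>t > 0\<close>.\<close>

definition RL_differentiable :: "real \<Rightarrow> (real \<Rightarrow> real) \<Rightarrow> bool" where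
  "RL_differentiable \<tau> f \<longleftrightarrow>
     (if \<tau> \<in> \<int> then times_differentiable_on (nat \<lfloor>\<tau>\<rfloor>) f {0<..}
      else (\<forall>t>0. set_integrable lborel {0<..<t} (\<lambda>u. (t - u) powr (of_int \<lfloor>\<tau>\<rfloor> - \<tau>) * f u)) \<and>
           times_differentiable_on (nat \<lfloor>\<tau>\<rfloor> + 1) (RL_kernel_integral \<tau> f) {0<..})"

definition tml_bracket ::
    "real \<Rightarrow> real \<Rightarrow> real \<Rightarrow> real \<Rightarrow> (real \<Rightarrow> real \<Rightarrow> real) \<Rightarrow> real \<Rightarrow> real \<Rightarrow> real" where
  "tml_bracket \<alpha> \<beta>\<^sub>1 lam\<^sub>1 \<mu> g x t =
     (ln lam\<^sub>1 - Digamma (\<beta>\<^sub>1 * t)) * tml_density \<alpha> \<beta>\<^sub>1 lam\<^sub>1 \<mu> g x t +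
     (LBINT y:{0<..}. tempered_density \<alpha> \<mu> g x y * ln y * gamma_sub_density lam\<^sub>1 \<beta>\<^sub>1 y t)"

end

theory Submission
  imports Defs "HOL-Complex_Analysis.Complex_Analysis" "HOL-Real_Asymp.Real_Asymp"
begin

text \<open>
  For \<open>t > 0\<close> the density is \<open>\<lambda>\<^sub>1\<^sup>s / \<Gamma>(s)\<close> times the Mellin transform in \<open>y\<close>, at
  \<open>s = \<beta>\<^sub>1 t\<close>, of a tempered version of \<open>y \<mapsto> g(x, y)\<close>. By self-similarity of the stable law,
  \<open>g(x, y) = r g(r x, 1)\<close> with \<open>r\<close> the power \<open>- 1 / \<alpha>\<close> of \<open>y\<close>, moments of the stable law at time 1 show that this transform
  converges for \<open>Re s > - 1 / 2\<close>; hence the density extends holomorphically across \<open>t = 0\<close>, where the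
  pole of \<open>\<Gamma>\<close> makes it vanish. Differentiation under the integral sign gives the case \<open>\<tau> = 1\<close>,
  and a function that is smooth up to \<open>0\<close> and vanishes there has as its derivative of order \<open>\<tau>\<close> that of order
  \<open>\<tau> - 1\<close> of its derivative.
\<close>

section \<open>Integrals depending on a complex parameter\<close>

text \<open>The obstacle is the behaviour at \<open>t = 0\<close>: the digamma factor has a pole
  there, yet the bracket must be integrable up to 0 against a singular kernel, and both kernel
  integrals must have derivatives of arbitrarily high order. The bracket is therefore never
  estimated. For \<open>t > 0\<close> the first-order equation identifies it with the derivative of
  the extension divided by \<open>\<beta>\<^sub>1\<close>, from which it inherits its bounds and all
  its derivatives. The bound -1/2 reflects spatial moments: under
  \<open>z = y powr (- 1 / \<alpha>) * x\<close> a power \<open>y powr s\<close> becomes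
  \<open>z powr (- \<alpha> * s)\<close> up to a constant, and the stable law has moments of
  positive order only below \<alpha>; the order \<alpha> / 2 is a choice. Since
  \<open>lam\<^sub>1\<close> may be smaller than \<open>\<mu> powr \<alpha>\<close>, the combined
  exponential factor in \<open>y\<close> may grow. This calls for exponential moments of
  \<open>z powr (- \<alpha>)\<close> at every rate \<open>K\<close>, which the fast decay of the
  stable density near 0 provides.\<close>

lemma set_borel_measurable_continuous:
  fixes f :: "'a::euclidean_space \<Rightarrow> 'b::real_normed_vector"
  assumes "A \<in> sets borel" "continuous_on A f"
  shows "set_borel_measurable lborel A f"
  unfolding set_borel_measurable_def
  using borel_measurable_continuous_on_indicator[OF assms] by simp

lemma continuous_on_Icc_boundedE:
  fixes \<phi> :: "real \<Rightarrow> 'a::real_normed_vector"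
  assumes "continuous_on {a..b} \<phi>"
  obtains C where "\<And>v. v \<in> {a..b} \<Longrightarrow> norm (\<phi> v) \<le> C"
proof -
  obtain C where "\<forall>y \<in> \<phi> ` {a..b}. norm y \<le> C"
    using compact_imp_bounded[OF compact_continuous_image[OF assms compact_Icc]]
    unfolding bounded_iff by blast
  then show thesis using that by blast
qed

text \<open>The mean value inequality on the convex ball bounds all difference quotients by
  \<open>B\<close>, and dominated convergence applies along sequences tending to \<open>z0\<close>.
  Measurability of \<open>f' z0\<close> comes from its being the pointwise limit of such
  quotients.\<close>

lemma
  fixes f f' :: "complex \<Rightarrow> 'a \<Rightarrow> complex"
  assumes r: "r > 0"
    and int: "\<And>z. z \<in> ball z0 r \<Longrightarrow> integrable M (f z)"
    and der: "\<And>z y. z \<in> ball z0 r \<Longrightarrow> y \<in> space M \<Longrightarrow> ((\<lambda>z. f z y) has_field_derivative f' z y) (at z)"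
    and bound: "\<And>z y. z \<in> ball z0 r \<Longrightarrow> y \<in> space M \<Longrightarrow> norm (f' z y) \<le> B y"
    and B: "integrable M B"
  shows integrable_derivative_dominated: "integrable M (f' z0)"
    and has_field_derivative_integral_dominated:
      "((\<lambda>z. \<integral>y. f z y \<partial>M) has_field_derivative (\<integral>y. f' z0 y \<partial>M)) (at z0)"
proof -
  have z0: "z0 \<in> ball z0 r" using r by simp
  have quotients: "integrable M (f' z0) \<and>
      (\<lambda>n. ((\<integral>y. f (X n) y \<partial>M) - (\<integral>y. f z0 y \<partial>M)) / (X n - z0)) \<longlonglongrightarrow> (\<integral>y. f' z0 y \<partial>M)"
    if X: "\<And>n. X n \<in> ball z0 r - {z0}" "X \<longlonglongrightarrow> z0" for X
  proof -
    define Q where "Q n y = (f (X n) y - f z0 y) / (X n - z0)" for n y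
    have Q_int: "integrable M (Q n)" for n
      unfolding Q_def using int[of "X n"] int[OF z0] X(1)[of n] by auto
    have Q_lim: "(\<lambda>n. Q n y) \<longlonglongrightarrow> f' z0 y" if "y \<in> space M" for y
    proof -
      have "((\<lambda>z. (f z y - f z0 y) / (z - z0)) \<longlongrightarrow> f' z0 y) (at z0)"
        using der[OF z0 that] by (simp add: has_field_derivative_iff)
      then show ?thesis
        using X unfolding tendsto_at_iff_sequentially Q_def comp_def by auto
    qed
    have Q_bound: "norm (Q n y) \<le> B y" if "y \<in> space M" for n y
    proof -
      have "norm (f (X n) y - f z0 y) \<le> B y * norm (X n - z0)"
        by (rule field_differentiable_bound[of "ball z0 r" "\<lambda>z. f z y" "\<lambda>z. f' z y"])
           (use X(1)[of n] z0 that der bound in \<open>auto intro: DERIV_subset\<close>)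
      then show ?thesis using X(1)[of n] by (simp add: Q_def norm_divide divide_simps)
    qed
    have meas: "f' z0 \<in> borel_measurable M"
      by (rule borel_measurable_LIMSEQ_metric[OF _ Q_lim]) (use Q_int in auto)
    have Q_bound': "AE y in M. norm (Q n y) \<le> B y" for n using Q_bound by auto
    have Q_lim': "AE y in M. (\<lambda>n. Q n y) \<longlonglongrightarrow> f' z0 y" using Q_lim by auto
    note dc = meas borel_measurable_integrable[OF Q_int] B Q_lim' Q_bound'
    have "integral\<^sup>L M (Q n) = ((\<integral>y. f (X n) y \<partial>M) - (\<integral>y. f z0 y \<partial>M)) / (X n - z0)" for n
      unfolding Q_def using int[of "X n"] int[OF z0] X(1)[of n] by auto
    then show ?thesis
      using integrable_dominated_convergence[OF dc] integral_dominated_convergence[OF dc] by simp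
  qed
  \<comment> \<open>Integrability of \<open>f' z0\<close> mentions no sequence, so one is exhibited;
    adding 2 keeps every \<open>X n\<close> strictly inside the open ball.\<close>
  define X where "X n = z0 + of_real (r / (real n + 2))" for n
  have "(\<lambda>n. r / (real n + 2)) \<longlonglongrightarrow> 0" by real_asymp
  from tendsto_add[OF tendsto_const[of z0] tendsto_of_real[OF this]] have "X \<longlonglongrightarrow> z0" by (simp add: X_def[abs_def])
  moreover have "X n \<in> ball z0 r - {z0}" for n
    using r by (auto simp: X_def dist_norm norm_divide divide_simps add_pos_nonneg simp flip: of_real_add of_real_divide)
  ultimately show "integrable M (f' z0)" using quotients by blast
  have "((\<lambda>z. ((\<integral>y. f z y \<partial>M) - (\<integral>y. f z0 y \<partial>M)) / (z - z0)) \<longlongrightarrow> (\<integral>y. f' z0 y \<partial>M)) (at z0 within ball z0 r)"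
    unfolding tendsto_at_iff_sequentially comp_def using quotients by blast
  then show "((\<lambda>z. \<integral>y. f z y \<partial>M) has_field_derivative (\<integral>y. f' z0 y \<partial>M)) (at z0)"
    using z0 by (simp add: has_field_derivative_iff at_within_open[OF z0 open_ball])
qed

section \<open>Riemann--Liouville derivatives of functions with a holomorphic extension\<close>

text \<open>\<open>Re\<close> commutes with differentiation along the real axis, so \<open>F\<close>
  need only match \<open>f\<close> in its real part. Iterated, this turns holomorphy into real
  derivatives of all orders.\<close>

lemma has_real_derivative_Re:
  assumes F: "F holomorphic_on A" "open A"
    and S: "open S" "of_real ` S \<subseteq> A" "\<And>t. t \<in> S \<Longrightarrow> f t = Re (F (of_real t))"
    and t: "t \<in> S"
  shows "(f has_real_derivative Re (deriv F (of_real t))) (at t)"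
proof -
  have "of_real t \<in> A" using S t by auto
  then have "(F has_field_derivative deriv F (of_real t)) (at (of_real t))"
    by (rule holomorphic_derivI[OF F])
  then have "((\<lambda>t. Re (F (of_real t))) has_vector_derivative Re (deriv F (of_real t))) (at t)"
    by (intro bounded_linear.has_vector_derivative[OF bounded_linear_Re] has_vector_derivative_real_field)
  then have "((\<lambda>t. Re (F (of_real t))) has_real_derivative Re (deriv F (of_real t))) (at t)"
    by (simp add: has_real_derivative_iff_has_vector_derivative)
  then show ?thesis
    by (rule has_field_derivative_transform_within_open[OF _ S(1) t]) (simp add: S)
qed

lemma higher_deriv_Re:
  assumes F: "F holomorphic_on A" "open A"
    and S: "open S" "of_real ` S \<subseteq> A" "\<And>t. t \<in> S \<Longrightarrow> f t = Re (F (of_real t))"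
    and t: "t \<in> S"
  shows "(deriv ^^ k) f t = Re ((deriv ^^ k) F (of_real t))"
  using t
proof (induction k arbitrary: t)
  case (Suc k)
  have "((deriv ^^ k) f has_real_derivative Re (deriv ((deriv ^^ k) F) (of_real t))) (at t)"
    by (rule has_real_derivative_Re[OF holomorphic_higher_deriv[OF F] F(2) S(1,2) Suc.IH Suc.prems])
  then show ?case by (simp add: DERIV_imp_deriv)
qed (simp add: S)

lemma times_differentiable_on_Re:
  assumes F: "F holomorphic_on A" "open A"
    and S: "open S" "of_real ` S \<subseteq> A" "\<And>t. t \<in> S \<Longrightarrow> f t = Re (F (of_real t))"
  shows "times_differentiable_on n f S"
  unfolding times_differentiable_on_def field_differentiable_def
  using has_real_derivative_Re[OF holomorphic_higher_deriv[OF F] F(2) S(1,2) higher_deriv_Re[OF F S]]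
  by blast

section \<open>Fractional integrals along segments from 0\<close>

text \<open>One of the \<open>Suc n\<close> derivatives is spent on the first-order equation. For
  integer orders this is applied to the functions themselves, otherwise to their kernel
  integrals.\<close>

lemma higher_deriv_Suc_cmult:
  fixes f b :: "real \<Rightarrow> real"
  assumes S: "open S" and der: "\<And>t. t \<in> S \<Longrightarrow> (f has_real_derivative c * b t) (at t)"
    and b: "times_differentiable_on n b S" and t: "t \<in> S"
  shows "(deriv ^^ Suc n) f t = c * (deriv ^^ n) b t"
  using b t
proof (induction n arbitrary: t)
  case 0
  then show ?case using der by (simp add: DERIV_imp_deriv)
next
  case (Suc n)
  have td: "times_differentiable_on n b S" "(deriv ^^ n) b field_differentiable (at t)"
    using Suc.prems by (auto simp: times_differentiable_on_def)
  have "eventually (\<lambda>s. s \<in> S) (nhds t)"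
    using S Suc.prems by (simp add: eventually_nhds_in_open)
  then have "eventually (\<lambda>s. (deriv ^^ Suc n) f s = c * (deriv ^^ n) b s) (nhds t)"
    by eventually_elim (rule Suc.IH[OF td(1)])
  then have "deriv ((deriv ^^ Suc n) f) t = deriv (\<lambda>s. c * (deriv ^^ n) b s) t"
    by (rule deriv_cong_ev) simp
  also have "\<dots> = c * deriv ((deriv ^^ n) b) t"
    using td(2) by (rule deriv_cmult)
  finally show ?case by simp
qed

lemma set_integrable_power_kernel:
  assumes a: "0 < a"
  shows "set_integrable lborel {0<..<1} (\<lambda>v::real. (1 - v) powr (a - 1))"
proof -
  \<comment> \<open>The Beta integrand with first parameter 1, whose factor \<open>v powr 0\<close>
    equals 1 inside the interval.\<close>
  have "set_integrable lborel {0<..<1} (\<lambda>v. v powr (1 - 1) * (1 - v) powr (a - 1))"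
    by (rule set_integrable_subset[OF integrable_Beta[OF _ a]]) auto
  then show ?thesis
    by (rule iffD1[OF set_integrable_cong, rotated -1]) auto
qed

lemma set_integrable_power_kernel_mult:
  fixes \<phi> :: "real \<Rightarrow> complex"
  assumes a: "0 < a" and \<phi>: "continuous_on {0..1} \<phi>"
  shows "set_integrable lborel {0<..<1} (\<lambda>v. of_real ((1 - v) powr (a - 1)) * \<phi> v)"
proof -
  obtain C where C: "\<And>v. v \<in> {0..1} \<Longrightarrow> norm (\<phi> v) \<le> C"
    using continuous_on_Icc_boundedE[OF \<phi>] by blast
  have "set_integrable lborel {0<..<1} (\<lambda>v::real. C * (1 - v) powr (a - 1))"
    using set_integrable_power_kernel[OF a] by simp
  then show ?thesis
  proof (rule set_integrable_bound)
    have "continuous_on {0<..<1} \<phi>" using \<phi> by (rule continuous_on_subset) auto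
    then have "continuous_on {0<..<1} (\<lambda>v. of_real ((1 - v) powr (a - 1)) * \<phi> v)"
      by (intro continuous_intros) auto
    then show "set_borel_measurable lborel {0<..<1} (\<lambda>v. of_real ((1 - v) powr (a - 1)) * \<phi> v)"
      by (intro set_borel_measurable_continuous) auto
    have "norm (of_real ((1 - v) powr (a - 1)) * \<phi> v) \<le> norm (C * (1 - v) powr (a - 1))"
      if "v \<in> {0<..<1}" for v
    proof -
      have "norm (\<phi> v) \<le> C" using C[of v] that by auto
      moreover from this have "0 \<le> C" using norm_ge_zero order_trans by blast
      ultimately show ?thesis
        by (simp add: norm_mult mult.commute[of C] mult_left_mono abs_mult)
    qed
    then show "AE v in lborel. v \<in> {0<..<1} \<longrightarrow>
        norm (of_real ((1 - v) powr (a - 1)) * \<phi> v) \<le> norm (C * (1 - v) powr (a - 1))"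
      by auto
  qed
qed

text \<open>Up to the factor \<^term>\<open>Gamma a\<close>, this is the Riemann--Liouville integral of order \<open>a\<close>, rescaled to \<open>u = z * v\<close>.\<close>

definition frac_integral :: "real \<Rightarrow> (complex \<Rightarrow> complex) \<Rightarrow> complex \<Rightarrow> complex" where
  "frac_integral a F z =
     z powr of_real a * (LBINT v:{0<..<1}. of_real ((1 - v) powr (a - 1)) * F (z * of_real v))"

text \<open>The half plane is star-shaped about 0, so the segment from 0 to \<open>z\<close> over
  which \<open>frac_integral\<close> integrates stays in the domain of \<open>F\<close>.\<close>

lemma scaled_in_half_plane:
  assumes "d > 0" "Re z > - d" "0 \<le> v" "v \<le> 1"
  shows "Re (z * of_real v) > - d"
proof (cases "Re z \<ge> 0")
  case True
  then have "Re z * v \<ge> 0" using assms by simp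
  then show ?thesis using assms by simp
next
  case False
  then have "Re z * 1 \<le> Re z * v" using assms by (intro mult_left_mono_neg) auto
  then show ?thesis using assms by simp
qed

lemma continuous_on_ray:
  assumes "continuous_on {w. - d < Re w} F" "d > 0" "Re z > - d"
  shows "continuous_on {0..1} (\<lambda>v. F (z * of_real v))"
  by (rule continuous_on_compose2[OF assms(1)])
     (use scaled_in_half_plane[OF assms(2,3)] in \<open>auto intro!: continuous_intros\<close>)

text \<open>After rescaling, neither the interval nor the singular weight depends on
  \<open>z\<close>. Only \<open>F\<close> is differentiated, and the integrable weight times a bound
  for \<open>deriv F\<close> dominates.\<close>

lemma has_field_derivative_ray_integral:
  assumes F: "F holomorphic_on {w. - d < Re w}" and d: "d > 0" and a: "0 < a"
    and z: "- d < Re z0"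
  shows "((\<lambda>z. LBINT v:{0<..<1}. of_real ((1 - v) powr (a - 1)) * F (z * of_real v)) has_field_derivative
     (LBINT v:{0<..<1}. of_real ((1 - v) powr (a - 1)) * (of_real v * deriv F (z0 * of_real v)))) (at z0)"
proof -
  let ?U = "{w. - d < Re w}"
  have U: "open ?U" by (rule open_halfspace_Re_gt)
  have F': "deriv F holomorphic_on ?U" using F U by (rule holomorphic_deriv)
  note contF = holomorphic_on_imp_continuous_on[OF F] and contF' = holomorphic_on_imp_continuous_on[OF F']
  obtain r where r: "r > 0" "cball z0 r \<subseteq> ?U"
    using z U by (auto simp: open_contains_cball)
  \<comment> \<open>The segments from 0 to the points of the closed ball fill a compact subset of
    the half plane, so one constant bounds \<open>deriv F\<close> on all of them.\<close>
  let ?S = "(\<lambda>(z, v::real). z * of_real v) ` (cball z0 r \<times> {0..1})"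
  have "compact ?S"
    by (intro compact_continuous_image compact_Times) (auto simp: case_prod_unfold intro!: continuous_intros)
  moreover have "?S \<subseteq> ?U" using r scaled_in_half_plane[OF d] by auto
  ultimately have "bounded (deriv F ` ?S)"
    by (metis compact_imp_bounded compact_continuous_image continuous_on_subset[OF contF'])
  then obtain C where "\<forall>w \<in> deriv F ` ?S. norm w \<le> C"
    unfolding bounded_iff by blast
  then have C: "norm (deriv F (z * of_real v)) \<le> C" if "z \<in> cball z0 r" "v \<in> {0..1}" for z v
    using that by (auto simp: image_iff)
  let ?w = "\<lambda>v::real. (1 - v) powr (a - 1)"
  have "((\<lambda>z. LINT v|lborel. indicator {0<..<1} v *\<^sub>R (of_real (?w v) * F (z * of_real v))) has_field_derivative
     (LINT v|lborel. indicator {0<..<1} v *\<^sub>R (of_real (?w v) * (of_real v * deriv F (z0 * of_real v))))) (at z0)"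
  proof (rule has_field_derivative_integral_dominated[OF r(1)])
    show "integrable lborel (\<lambda>v. indicator {0<..<1} v *\<^sub>R (of_real (?w v) * F (z * of_real v)))"
      if "z \<in> ball z0 r" for z
    proof -
      have "z \<in> cball z0 r" using that by simp
      then have "- d < Re z" using r(2) by blast
      then show ?thesis
        using set_integrable_power_kernel_mult[OF a continuous_on_ray[OF contF d]]
        by (simp add: set_integrable_def)
    qed
    show "((\<lambda>z. indicator {0<..<1} v *\<^sub>R (of_real (?w v) * F (z * of_real v))) has_field_derivative
        indicator {0<..<1} v *\<^sub>R (of_real (?w v) * (of_real v * deriv F (z * of_real v)))) (at z)"
      if "z \<in> ball z0 r" for z v
    proof (cases "v \<in> {0<..<1}")
      case True
      moreover have "z \<in> cball z0 r" using that by simp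
      then have "- d < Re z" using r(2) by blast
      ultimately have "z * of_real v \<in> ?U" using scaled_in_half_plane[OF d, of z v] by auto
      then have D: "(F has_field_derivative deriv F (z * of_real v)) (at (z * of_real v))"
        by (rule holomorphic_derivI[OF F U])
      have "((\<lambda>z. F (z * of_real v)) has_field_derivative deriv F (z * of_real v) * of_real v) (at z)"
        by (rule DERIV_chain2[where g = "\<lambda>z. z * of_real v" and x = z, OF D]) (auto intro!: derivative_eq_intros)
      from DERIV_cmult[OF this, of "of_real (?w v)"] True show ?thesis
        by (simp add: mult_ac)
    qed simp
    show "norm (indicator {0<..<1} v *\<^sub>R (of_real (?w v) * (of_real v * deriv F (z * of_real v))) :: complex)
        \<le> indicator {0<..<1} v *\<^sub>R (C * ?w v)" if "z \<in> ball z0 r" for z v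
    proof (cases "v \<in> {0<..<1}")
      case True
      then have "norm (deriv F (z * of_real v)) \<le> C" using that by (intro C) auto
      then have "v * norm (deriv F (z * of_real v)) \<le> 1 * C" using True by (intro mult_mono) auto
      then show ?thesis using True by (simp add: norm_mult mult.commute[of C] mult_left_mono)
    qed simp
    show "integrable lborel (\<lambda>v. indicator {0<..<1} v *\<^sub>R (C * ?w v))"
      using set_integrable_power_kernel[OF a] unfolding set_integrable_def by (simp add: mult.left_commute)
  qed
  then show ?thesis by (simp add: set_lebesgue_integral_def)
qed

text \<open>The boundary function \<open>(1 - v) powr a * F (z * v)\<close> vanishes at
  \<open>v = 1\<close> because \<open>a > 0\<close>, and at \<open>v = 0\<close> because
  \<open>F 0 = 0\<close>.\<close>

lemma integration_by_parts_ray: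
  assumes F: "F holomorphic_on {w. - d < Re w}" and d: "d > 0" and a: "0 < a"
    and z: "- d < Re z" and F0: "F 0 = 0"
  shows "of_real a * (LBINT v:{0<..<1}. of_real ((1 - v) powr (a - 1)) * F (z * of_real v)) =
    z * (LBINT v:{0<..<1}. of_real ((1 - v) powr (a - 1)) * ((1 - of_real v) * deriv F (z * of_real v)))"
proof -
  let ?U = "{w. - d < Re w}"
  have U: "open ?U" by (rule open_halfspace_Re_gt)
  have F': "deriv F holomorphic_on ?U" using F U by (rule holomorphic_deriv)
  note contF = holomorphic_on_imp_continuous_on[OF F] and contF' = holomorphic_on_imp_continuous_on[OF F']
  let ?w = "\<lambda>v::real. (1 - v) powr (a - 1)"
  define \<phi> where "\<phi> v = of_real ((1 - v) powr a) * F (z * of_real v)" for v :: real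
  define f1 where "f1 v = of_real (?w v) * F (z * of_real v)" for v
  define f2 where "f2 v = of_real (?w v) * ((1 - of_real v) * deriv F (z * of_real v))" for v
  have int: "set_integrable lborel {0<..<1} f1" "set_integrable lborel {0<..<1} f2"
  proof -
    show "set_integrable lborel {0<..<1} f1"
      unfolding f1_def by (rule set_integrable_power_kernel_mult[OF a continuous_on_ray[OF contF d z]])
    show "set_integrable lborel {0<..<1} f2"
      unfolding f2_def
      by (intro set_integrable_power_kernel_mult[OF a] continuous_on_mult continuous_on_diff
          continuous_on_const continuous_on_of_real continuous_on_id continuous_on_ray[OF contF' d z])
  qed
  \<comment> \<open>For \<open>a < 1\<close> the power is not differentiable at
    \<open>v = 1\<close>, hence the form of the fundamental theorem that asks for derivatives only
    in the interior.\<close>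
  have "((\<lambda>v. z * f2 v - of_real a * f1 v) has_integral (\<phi> 1 - \<phi> 0)) {0..1}"
  proof (rule fundamental_theorem_of_calculus_interior)
    show "continuous_on {0..1} \<phi>"
      unfolding \<phi>_def
      by (intro continuous_on_mult continuous_on_of_real continuous_on_powr' continuous_on_diff
          continuous_on_const continuous_on_id continuous_on_ray[OF contF d z]) (use a in auto)
    fix v :: real assume v: "v \<in> {0<..<1}"
    then have "z * of_real v \<in> ?U" using scaled_in_half_plane[OF d z, of v] by auto
    then have D: "(F has_field_derivative deriv F (z * of_real v)) (at (z * of_real v))"
      by (rule holomorphic_derivI[OF F U])
    have "((\<lambda>w. F (z * w)) has_field_derivative deriv F (z * of_real v) * z) (at (of_real v))"
      by (rule DERIV_chain2[where g = "\<lambda>w. z * w" and x = "of_real v", OF D]) (auto intro!: derivative_eq_intros)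
    then have 1: "((\<lambda>v. F (z * of_real v)) has_vector_derivative deriv F (z * of_real v) * z) (at v)"
      by (rule has_vector_derivative_real_field)
    have "((\<lambda>v. (1 - v) powr a) has_real_derivative - a * ?w v) (at v)"
      using v by (auto intro!: derivative_eq_intros)
    then have 2: "((\<lambda>v. of_real ((1 - v) powr a) :: complex) has_vector_derivative of_real (- a * ?w v)) (at v)"
      by (intro has_vector_derivative_of_real) (simp add: has_real_derivative_iff_has_vector_derivative)
    have split: "z * (w * (u * D)) - A * (w * X) = (w * u) * (D * z) + (- A * w) * X" for w u D A X :: complex
      by (simp add: algebra_simps)
    have w: "(1 - v) powr a = ?w v * (1 - v)" using v by (simp add: powr_mult_base powr_diff)
    have "z * f2 v - of_real a * f1 v =
        of_real ((1 - v) powr a) * (deriv F (z * of_real v) * z) + of_real (- a * ?w v) * F (z * of_real v)"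
      by (simp only: f1_def f2_def w of_real_mult of_real_minus of_real_diff of_real_1 split)
    then show "(\<phi> has_vector_derivative z * f2 v - of_real a * f1 v) (at v)"
      unfolding \<phi>_def using has_vector_derivative_mult[OF 2 1] by simp
  qed simp
  moreover have "\<phi> 1 = 0" "\<phi> 0 = 0" using a F0 by (auto simp: \<phi>_def)
  ultimately have "integral {0<..<1} (\<lambda>v. z * f2 v - of_real a * f1 v) = 0"
    by (simp add: has_integral_Icc_iff_Ioo integral_unique)
  moreover have "set_integrable lborel {0<..<1} (\<lambda>v. z * f2 v - of_real a * f1 v)"
    using int by (intro set_integral_diff) auto
  ultimately have "(LBINT v:{0<..<1}. z * f2 v - of_real a * f1 v) = 0"
    by (simp add: set_borel_integral_eq_integral)
  then show ?thesis
    using int by (simp add: set_integral_diff flip: f1_def f2_def)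
qed

text \<open>By the product rule, differentiating under the integral contributes the weight
  \<open>v\<close>, and differentiating the outer power contributes, after integration by parts, the
  weight \<open>1 - v\<close>; they add up to 1. The half plane \<open>0 < Re z\<close> avoids the
  branch cut of the power.\<close>

lemma has_field_derivative_frac_integral:
  assumes F: "F holomorphic_on {w. - d < Re w}" and d: "d > 0" and a: "0 < a" and F0: "F 0 = 0"
    and z: "0 < Re z"
  shows "(frac_integral a F has_field_derivative frac_integral a (deriv F) z) (at z)"
proof -
  let ?I = "\<lambda>\<phi>. LBINT v:{0<..<1}. of_real ((1 - v) powr (a - 1)) * \<phi> v"
  let ?F' = "\<lambda>v. deriv F (z * of_real v)"
  have zd: "- d < Re z" and z0: "z \<noteq> 0" "z \<notin> \<real>\<^sub>\<le>\<^sub>0"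
    using z d by (auto simp: complex_nonpos_Reals_iff)
  have U: "open {w. - d < Re w}" by (rule open_halfspace_Re_gt)
  have F': "deriv F holomorphic_on {w. - d < Re w}" using F U by (rule holomorphic_deriv)
  have cont: "continuous_on {0..1} ?F'"
    by (rule continuous_on_ray[OF holomorphic_on_imp_continuous_on[OF F'] d zd])
  have 1: "((\<lambda>z. z powr of_real a * ?I (\<lambda>v. F (z * of_real v))) has_field_derivative
      z powr of_real a * ?I (\<lambda>v. of_real v * ?F' v) + (of_real a * z powr (of_real a - 1)) * ?I (\<lambda>v. F (z * of_real v))) (at z)"
    by (rule DERIV_mult'[OF has_field_derivative_powr[OF z0(2)] has_field_derivative_ray_integral[OF F d a zd]])
  have split: "w * (v * u) + w * ((1 - v) * u) = w * u" for w v u :: complex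
    by (simp add: algebra_simps)
  have "z powr of_real a = z * z powr (of_real a - 1)" using z0 by (simp add: powr_diff)
  then have A: "(of_real a * z powr (of_real a - 1)) * ?I (\<lambda>v. F (z * of_real v)) =
      z powr of_real a * ?I (\<lambda>v. (1 - of_real v) * ?F' v)"
    using integration_by_parts_ray[OF F d a zd F0] by (simp add: mult_ac)
  have B: "?I (\<lambda>v. of_real v * ?F' v) + ?I (\<lambda>v. (1 - of_real v) * ?F' v) = ?I ?F'"
  proof (subst set_integral_add(2)[symmetric])
    show "set_integrable lborel {0<..<1} (\<lambda>v. of_real ((1 - v) powr (a - 1)) * (of_real v * ?F' v))"
      "set_integrable lborel {0<..<1} (\<lambda>v. of_real ((1 - v) powr (a - 1)) * ((1 - of_real v) * ?F' v))"
      by (intro set_integrable_power_kernel_mult a continuous_intros cont)+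
    show "(LBINT v:{0<..<1}. of_real ((1 - v) powr (a - 1)) * (of_real v * ?F' v) +
        of_real ((1 - v) powr (a - 1)) * ((1 - of_real v) * ?F' v)) = ?I ?F'"
      by (simp only: split)
  qed
  have "z powr of_real a * ?I (\<lambda>v. of_real v * ?F' v) + (of_real a * z powr (of_real a - 1)) * ?I (\<lambda>v. F (z * of_real v))
      = frac_integral a (deriv F) z"
    unfolding frac_integral_def A by (simp only: distrib_left[symmetric] B)
  with 1 show ?thesis by (simp add: frac_integral_def[abs_def])
qed

lemma half_plane_subset: "d > 0 \<Longrightarrow> of_real ` {0<..} \<subseteq> {w. - d < Re w}"
  by auto

text \<open>The substitution \<open>u = t * v\<close>: the factor \<open>t\<close> from the measure
  and \<open>t powr (a - 1)\<close> from the kernel combine to the outer power in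
  \<open>frac_integral\<close>.\<close>

lemma
  assumes F: "F holomorphic_on {w. - d < Re w}" and d: "d > 0" and a: "0 < a"
    and f: "\<And>t. t > 0 \<Longrightarrow> f t = Re (F (of_real t))" and t: "t > 0"
  shows set_integrable_frac_integral: "set_integrable lborel {0<..<t} (\<lambda>u. (t - u) powr (a - 1) * f u)"
    and Re_frac_integral: "(LBINT u:{0<..<t}. (t - u) powr (a - 1) * f u) = Re (frac_integral a F (of_real t))"
proof -
  let ?h = "\<lambda>v. of_real ((1 - v) powr (a - 1)) * F (of_real t * of_real v)"
  define k where "k u = indicator {0<..<t} u *\<^sub>R ((t - u) powr (a - 1) * f u)" for u
  have int: "set_integrable lborel {0<..<1} ?h"
    by (intro set_integrable_power_kernel_mult a continuous_on_ray[OF holomorphic_on_imp_continuous_on[OF F] d])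
       (use t d in auto)
  have k: "k (0 + t * v) = t powr (a - 1) * Re (indicator {0<..<1} v *\<^sub>R ?h v)" for v
  proof (cases "v \<in> {0<..<1}")
    case True
    then have "(t - t * v) powr (a - 1) = t powr (a - 1) * (1 - v) powr (a - 1)"
      using t by (simp add: powr_mult[symmetric] algebra_simps)
    then show ?thesis using True t by (simp add: k_def f)
  next
    case False
    then show ?thesis using t by (auto simp: k_def indicator_def zero_less_mult_iff)
  qed
  have int_k: "integrable lborel (\<lambda>v. k (0 + t * v))"
    unfolding k using int unfolding set_integrable_def by (intro integrable_mult_right integrable_Re)
  then show "set_integrable lborel {0<..<t} (\<lambda>u. (t - u) powr (a - 1) * f u)"
    using t lborel_integrable_real_affine_iff[of t k 0] by (simp add: set_integrable_def k_def[abs_def])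
  have "(LBINT u. k u) = t * (LBINT v. k (0 + t * v))"
    using lborel_integral_real_affine[of t k 0] t by simp
  also have "\<dots> = t * (t powr (a - 1) * Re (LBINT v:{0<..<1}. ?h v))"
    unfolding k set_lebesgue_integral_def integral_Re[OF int[unfolded set_integrable_def], symmetric]
      integral_mult_right_zero by (rule refl)
  also have "\<dots> = Re (frac_integral a F (of_real t))"
  proof -
    have "t * t powr (a - 1) = t powr a" using t by (simp add: powr_mult_base)
    then show ?thesis using t
      by (simp add: frac_integral_def powr_of_real flip: mult.assoc)
  qed
  finally show "(LBINT u:{0<..<t}. (t - u) powr (a - 1) * f u) = Re (frac_integral a F (of_real t))"
    by (simp add: k_def set_lebesgue_integral_def)
qed

text \<open>Holomorphy across \<open>0\<close> together with \<open>F 0 = 0\<close> removes the boundary term in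
  \<open>d/dt I\<^sup>a f = I\<^sup>a f'\<close>.\<close>

lemma RL_deriv_eq_RL_deriv_of_deriv:
  fixes f b :: "real \<Rightarrow> real"
  assumes F: "F holomorphic_on {w. - d < Re w}" and d: "d > 0" and F0: "F 0 = 0"
    and f: "\<And>t. t > 0 \<Longrightarrow> f t = Re (F (of_real t))"
    and der: "\<And>t. t > 0 \<Longrightarrow> (f has_real_derivative c * b t) (at t)"
    and c: "c \<noteq> 0" and \<tau>: "\<tau> \<ge> 1"
  shows "RL_differentiable \<tau> f" "RL_differentiable (\<tau> - 1) b"
    "t > 0 \<Longrightarrow> RL_deriv \<tau> f t = c * RL_deriv (\<tau> - 1) b t"
proof -
  let ?U = "{w. - d < Re w}"
  define G where "G w = deriv F w / of_real c" for w
  have U: "open ?U" "open {0::real<..}" by (auto simp: open_halfspace_Re_gt)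
  have F': "deriv F holomorphic_on ?U" using F U(1) by (rule holomorphic_deriv)
  have G: "G holomorphic_on ?U" unfolding G_def by (intro holomorphic_intros F') (use c in auto)
  note sub = half_plane_subset[OF d]
  \<comment> \<open>\<open>b\<close> is accessible only through \<open>der\<close>; uniqueness of
    the derivative makes it the real part of a function holomorphic across 0.\<close>
  have b: "b t = Re (G (of_real t))" if "t > 0" for t
  proof -
    have "(f has_real_derivative Re (deriv F (of_real t))) (at t)"
      by (rule has_real_derivative_Re[OF F U sub]) (use f that in auto)
    from DERIV_unique[OF this der[OF that]] c show ?thesis by (simp add: G_def)
  qed
  have fb: "times_differentiable_on n f {0<..}" "times_differentiable_on n b {0<..}" for n
    by (rule times_differentiable_on_Re[OF F U sub] times_differentiable_on_Re[OF G U sub]; use f b in simp)+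
  define m where "m = nat \<lfloor>\<tau> - 1\<rfloor>"
  have "1 \<le> \<lfloor>\<tau>\<rfloor>" using \<tau> by (simp add: le_floor_iff)
  have m: "nat \<lfloor>\<tau>\<rfloor> = Suc m" "nat \<lfloor>\<tau> - 1\<rfloor> = m" 
    using \<open>1 \<le> \<lfloor>\<tau>\<rfloor>\<close> unfolding m_def floor_diff_one by linarith+
  have "RL_differentiable \<tau> f \<and> RL_differentiable (\<tau> - 1) b \<and>
      (\<forall>t>0. RL_deriv \<tau> f t = c * RL_deriv (\<tau> - 1) b t)"
  proof (cases "\<tau> \<in> \<int>")
    case True
    then have "\<tau> - 1 \<in> \<int>" by simp
    then show ?thesis
      using True fb higher_deriv_Suc_cmult[OF U(2) der fb(2)]
      unfolding RL_differentiable_def RL_deriv_def m by (simp del: funpow.simps)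
  next
    case False
    then have \<tau>1: "\<tau> - 1 \<notin> \<int>" by (metis Ints_1 Ints_add diff_add_cancel)
    \<comment> \<open>The kernel depends only on the fractional part of the order, so \<tau> and
      \<tau> - 1 share the same \<open>a\<close>.\<close>
    define a where "a = of_int \<lfloor>\<tau>\<rfloor> + 1 - \<tau>"
    have a: "0 < a" unfolding a_def by linarith
    have e: "of_int \<lfloor>\<tau>\<rfloor> - \<tau> = a - 1" "of_int \<lfloor>\<tau> - 1\<rfloor> - (\<tau> - 1) = a - 1"
      "of_int \<lfloor>\<tau>\<rfloor> + 1 - \<tau> = a" "of_int \<lfloor>\<tau> - 1\<rfloor> + 1 - (\<tau> - 1) = a"
      by (simp_all add: a_def)
    let ?Kf = "RL_kernel_integral \<tau> f" and ?Kb = "RL_kernel_integral (\<tau> - 1) b"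
    let ?V = "{w. 0 < Re w}"
    have V: "open ?V" "of_real ` {0<..} \<subseteq> ?V" by (auto simp: open_halfspace_Re_gt)
    have KF: "(frac_integral a F has_field_derivative frac_integral a (deriv F) z) (at z)" if "z \<in> ?V" for z
      using has_field_derivative_frac_integral[OF F d a F0] that by simp
    have KF_holo: "frac_integral a F holomorphic_on ?V"
      using KF V(1) by (auto simp: holomorphic_on_open)
    have KG: "frac_integral a (deriv F) z = of_real c * frac_integral a G z" for z
    proof -
      have "(LBINT v:{0<..<1}. of_real ((1 - v) powr (a - 1)) * deriv F (z * of_real v)) =
          (LBINT v:{0<..<1}. of_real c * (of_real ((1 - v) powr (a - 1)) * G (z * of_real v)))"
        using c by (intro set_lebesgue_integral_cong) (auto simp: G_def)
      then show ?thesis by (simp add: frac_integral_def)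
    qed
    have "deriv (frac_integral a F) holomorphic_on ?V"
      using KF_holo V(1) by (rule holomorphic_deriv)
    moreover have "deriv (frac_integral a F) z = of_real c * frac_integral a G z" if "z \<in> ?V" for z
      using DERIV_imp_deriv[OF KF[OF that]] by (simp add: KG)
    ultimately have "(\<lambda>z. deriv (frac_integral a F) z / of_real c) holomorphic_on ?V"
      "\<And>z. z \<in> ?V \<Longrightarrow> deriv (frac_integral a F) z / of_real c = frac_integral a G z"
      using c by (auto intro!: holomorphic_intros)
    then have KG_holo: "frac_integral a G holomorphic_on ?V"
      by (rule holomorphic_transform)
    have Kf: "?Kf t = Re (frac_integral a F (of_real t))" if "t \<in> {0<..}" for t
      using Re_frac_integral[OF F d a f, of t] that unfolding RL_kernel_integral_def e by simp
    have Kb: "?Kb t = Re (frac_integral a G (of_real t))" if "t \<in> {0<..}" for t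
      using Re_frac_integral[OF G d a b, of t] that unfolding RL_kernel_integral_def e by simp
    have diff: "times_differentiable_on n ?Kf {0<..}" "times_differentiable_on n ?Kb {0<..}" for n
      by (rule times_differentiable_on_Re[OF KF_holo V(1) U(2) V(2) Kf]
          times_differentiable_on_Re[OF KG_holo V(1) U(2) V(2) Kb]; assumption)+
    have "(?Kf has_real_derivative c * ?Kb t) (at t)" if "t \<in> {0<..}" for t
    proof -
      have "deriv (frac_integral a F) (of_real t) = of_real c * frac_integral a G (of_real t)"
        using DERIV_imp_deriv[OF KF, of "of_real t"] that by (simp add: KG)
      then show ?thesis
        using has_real_derivative_Re[OF KF_holo V(1) U(2) V(2) Kf that] by (simp add: Kb[OF that])
    qed
    \<comment> \<open>The kernel integrals carry one outer derivative more than the integer parts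
      \<open>Suc m\<close> and \<open>m\<close> of the two orders.\<close>
    from higher_deriv_Suc_cmult[OF U(2) this diff(2)]
    have "(deriv ^^ Suc (Suc m)) ?Kf t = c * (deriv ^^ Suc m) ?Kb t" if "t > 0" for t
      using that by blast
    moreover have "set_integrable lborel {0<..<t} (\<lambda>u. (t - u) powr (a - 1) * f u)"
      "set_integrable lborel {0<..<t} (\<lambda>u. (t - u) powr (a - 1) * b u)" if "t > 0" for t
      using set_integrable_frac_integral[OF F d a f that] set_integrable_frac_integral[OF G d a b that] by auto
    ultimately show ?thesis
      using False \<tau>1 diff
      unfolding RL_differentiable_def RL_deriv_def e m Suc_eq_plus1[symmetric]
      by (simp del: funpow.simps)
  qed
  then show "RL_differentiable \<tau> f" "RL_differentiable (\<tau> - 1) b"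
    "t > 0 \<Longrightarrow> RL_deriv \<tau> f t = c * RL_deriv (\<tau> - 1) b t" by auto
qed

section \<open>Self-similarity and moments of the stable density\<close>

text \<open>With \<open>v = exp (- x)\<close> the hypothesis says that all moments of a finite signed measure on
  \<open>[0, 1]\<close> vanish, so the Weierstrass approximation theorem applies.\<close>

lemma Laplace_transform_zero_imp_zero:
  fixes h :: "real \<Rightarrow> real"
  assumes cont: "continuous_on {0<..} h"
    and int: "\<And>n::nat. set_integrable lborel {0<..} (\<lambda>x. exp (- real n * x) * h x)"
    and zero: "\<And>n::nat. (LBINT x:{0<..}. exp (- real n * x) * h x) = 0"
    and x0: "x0 > 0"
  shows "h x0 = 0"
proof (rule ccontr)
  assume nz: "h x0 \<noteq> 0"
  have int_h: "set_integrable lborel {0<..} h" using int[of 0] by simp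
  have int_comp: "set_integrable lborel {0<..} (\<lambda>x. \<phi> (exp (- x)) * h x)"
    if \<phi>: "continuous_on {0..1} \<phi>" for \<phi> :: "real \<Rightarrow> real"
  proof -
    obtain C where C: "\<And>v. v \<in> {0..1} \<Longrightarrow> norm (\<phi> v) \<le> C"
      using continuous_on_Icc_boundedE[OF \<phi>] by blast
    show ?thesis
    proof (rule set_integrable_bound)
      show "set_integrable lborel {0<..} (\<lambda>x. C * h x)" using int_h by simp
      have "continuous_on {0<..} (\<lambda>x. \<phi> (exp (- x)) * h x)"
        by (intro continuous_on_mult cont continuous_on_compose2[OF \<phi>] continuous_intros) auto
      then show "set_borel_measurable lborel {0<..} (\<lambda>x. \<phi> (exp (- x)) * h x)"
        by (intro set_borel_measurable_continuous) auto
      have "norm (\<phi> (exp (- x)) * h x) \<le> norm (C * h x)" if "x \<in> {0<..}" for x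
      proof -
        have "\<bar>\<phi> (exp (- x))\<bar> \<le> \<bar>C\<bar>" using C[of "exp (- x)"] that by auto
        then show ?thesis by (simp add: abs_mult mult_right_mono)
      qed
      then show "AE x in lborel. x \<in> {0<..} \<longrightarrow> norm (\<phi> (exp (- x)) * h x) \<le> norm (C * h x)"
        by auto
    qed
  qed
  have zero_comp: "(LBINT x:{0<..}. \<phi> (exp (- x)) * h x) = 0"
    if \<phi>: "continuous_on {0..1} \<phi>" for \<phi> :: "real \<Rightarrow> real"
  proof -
    define N where "N = (LBINT x:{0<..}. \<bar>h x\<bar>)"
    have int_abs: "set_integrable lborel {0<..} (\<lambda>x. \<bar>h x\<bar>)"
      using int_h by (rule set_integrable_abs)
    have N: "N \<ge> 0" unfolding N_def set_lebesgue_integral_def by (intro integral_nonneg_AE) auto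
    have small: "\<bar>LBINT x:{0<..}. \<phi> (exp (- x)) * h x\<bar> \<le> e * N" if e: "e > 0" for e
    proof -
      obtain p where p: "real_polynomial_function p" "\<And>v. v \<in> {0..1} \<Longrightarrow> \<bar>\<phi> v - p v\<bar> < e"
        using Stone_Weierstrass_real_polynomial_function[OF compact_Icc \<phi> e] by blast
      then obtain c m where pc: "p = (\<lambda>v. \<Sum>i\<le>m. c i * v ^ i)"
        by (auto simp: real_polynomial_function_iff_sum)
      have contp: "continuous_on {0..1} p" unfolding pc by (intro continuous_intros)
      have "(LBINT x:{0<..}. p (exp (- x)) * h x) =
          (LBINT x:{0<..}. \<Sum>i\<le>m. c i * (exp (- real i * x) * h x))"
        unfolding pc by (simp add: sum_distrib_left exp_of_nat_mult[symmetric] mult_ac)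
      also have "\<dots> = (\<Sum>i\<le>m. LBINT x:{0<..}. c i * (exp (- real i * x) * h x))"
        unfolding set_lebesgue_integral_def scaleR_sum_right
        using int by (intro Bochner_Integration.integral_sum) (auto simp: set_integrable_def mult.left_commute)
      also have "\<dots> = 0" using zero by simp
      finally have p0: "(LBINT x:{0<..}. p (exp (- x)) * h x) = 0" .
      have int_diff: "set_integrable lborel {0<..} (\<lambda>x. (\<phi> (exp (- x)) - p (exp (- x))) * h x)"
        using int_comp[of "\<lambda>v. \<phi> v - p v"] \<phi> contp by (auto intro: continuous_intros)
      have "(LBINT x:{0<..}. \<phi> (exp (- x)) * h x) =
          (LBINT x:{0<..}. (\<phi> (exp (- x)) - p (exp (- x))) * h x)"
        using p0 int_comp[OF \<phi>] int_comp[OF contp] by (simp add: left_diff_distrib)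
      also have "\<bar>\<dots>\<bar> \<le> (LBINT x:{0<..}. \<bar>(\<phi> (exp (- x)) - p (exp (- x))) * h x\<bar>)"
        using set_integral_norm_bound[OF int_diff] by simp
      also have "\<dots> \<le> (LBINT x:{0<..}. e * \<bar>h x\<bar>)"
      proof (rule set_integral_mono)
        fix x :: real assume "x \<in> {0<..}"
        then have "\<bar>\<phi> (exp (- x)) - p (exp (- x))\<bar> \<le> e" using p(2)[of "exp (- x)"] by simp
        then show "\<bar>(\<phi> (exp (- x)) - p (exp (- x))) * h x\<bar> \<le> e * \<bar>h x\<bar>"
          by (simp add: abs_mult mult_right_mono)
      qed (use int_abs set_integrable_abs[OF int_diff] in auto)
      also have "\<dots> = e * N" by (simp add: N_def)
      finally show ?thesis .
    qed
    have "\<bar>LBINT x:{0<..}. \<phi> (exp (- x)) * h x\<bar> \<le> 0 + e" if "e > 0" for e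
    proof -
      \<comment> \<open>\<open>N\<close> may be 0, hence the denominator
        \<open>N + 1\<close>.\<close>
      have "e / (N + 1) * N \<le> e" using N that by (simp add: field_simps)
      then show ?thesis using small[of "e / (N + 1)"] N that by simp
    qed
    then show ?thesis using field_le_epsilon by (metis abs_le_zero_iff)
  qed
  have "isCont h x0" using cont x0 by (simp add: continuous_on_eq_continuous_at)
  then have "isCont (\<lambda>x. h x0 * h x) x0" by (intro continuous_intros)
  moreover have "h x0 * h x0 > 0" using nz not_real_square_gt_zero by blast
  ultimately have "eventually (\<lambda>x. h x0 * h x > 0) (at x0)"
    unfolding isCont_def by (rule order_tendstoD)
  then obtain \<delta> where \<delta>: "\<delta> > 0" "\<And>x. x \<noteq> x0 \<Longrightarrow> dist x x0 < \<delta> \<Longrightarrow> h x0 * h x > 0"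
    unfolding eventually_at by auto
  \<comment> \<open>A tent in the variable \<open>v = exp (- x)\<close>, positive exactly for x
    within distance \<delta> of \<open>x0\<close>. The factor \<open>h x0\<close> in
    \<open>k\<close> fixes the sign, so that \<open>k\<close> is nonnegative and its zero integral
    forces it to vanish almost everywhere.\<close>
  define l r where "l = exp (- (x0 + \<delta>))" and "r = exp (- (x0 - \<delta>))"
  define \<phi> where "\<phi> v = max 0 (min (v - l) (r - v))" for v
  define k where "k x = h x0 * (\<phi> (exp (- x)) * h x)" for x
  have \<phi>: "continuous_on {0..1} \<phi>" unfolding \<phi>_def by (intro continuous_intros)
  have pos: "k x > 0" if "\<bar>x - x0\<bar> < \<delta>" for x
  proof -
    have "h x0 * h x > 0" using \<delta>(2)[of x] that \<open>h x0 * h x0 > 0\<close> by (cases "x = x0") (auto simp: dist_real_def)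
    moreover have "\<phi> (exp (- x)) > 0" using that by (auto simp: \<phi>_def l_def r_def less_max_iff_disj)
    ultimately have "h x0 * h x * \<phi> (exp (- x)) > 0" by (rule mult_pos_pos)
    then show ?thesis by (simp add: k_def mult_ac)
  qed
  have "k x = 0" if "\<bar>x - x0\<bar> \<ge> \<delta>" for x
  proof -
    have "exp (- x) \<ge> r \<or> exp (- x) \<le> l" using that by (auto simp: l_def r_def)
    then show ?thesis by (auto simp: k_def \<phi>_def)
  qed
  with pos have nonneg: "k x \<ge> 0" for x by (metis less_le not_less order_refl)
  have int_k: "integrable lborel (\<lambda>x. indicator {0<..} x *\<^sub>R k x)"
    using int_comp[OF \<phi>] by (simp add: set_integrable_def k_def mult.left_commute)
  moreover have "(LBINT x. indicator {0<..} x *\<^sub>R k x) = 0"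
  proof -
    have "(LBINT x:{0<..}. h x0 * (\<phi> (exp (- x)) * h x)) = 0" using zero_comp[OF \<phi>] by simp
    then show ?thesis by (simp only: k_def set_lebesgue_integral_def)
  qed
  ultimately have "AE x in lborel. indicator {0<..} x *\<^sub>R k x = 0"
    using nonneg by (subst (asm) integral_nonneg_eq_0_iff_AE) auto
  then obtain Z where Z: "{x. indicator {0<..} x *\<^sub>R k x \<noteq> 0} \<subseteq> Z" "emeasure lborel Z = 0" "Z \<in> sets lborel"
    by (auto elim!: AE_E)
  \<comment> \<open>\<delta> may exceed \<open>x0\<close>; cutting at 0 still leaves an interval of
    positive length on which the integrand is positive.\<close>
  define m where "m = max 0 (x0 - \<delta>)"
  have "{m<..<x0} \<subseteq> Z"
  proof
    fix x assume x: "x \<in> {m<..<x0}"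
    then have "\<bar>x - x0\<bar> < \<delta>" "x > 0" by (auto simp: m_def)
    then have "indicator {0<..} x *\<^sub>R k x \<noteq> 0" using pos[of x] by simp
    then show "x \<in> Z" using Z(1) by blast
  qed
  then have "emeasure lborel {m<..<x0} \<le> emeasure lborel Z" using Z(3) by (rule emeasure_mono)
  then show False using Z(2) x0 \<delta>(1) by (simp add: m_def)
qed

lemma
  assumes g: "stable_density \<alpha> g" and t: "t > 0"
  shows stable_density_nonneg: "x > 0 \<Longrightarrow> g x t \<ge> 0"
    and stable_density_continuous: "continuous_on {0<..} (\<lambda>x. g x t)"
    and stable_density_integrable: "u \<ge> 0 \<Longrightarrow> set_integrable lborel {0<..} (\<lambda>x. exp (- u * x) * g x t)"
    and stable_density_Laplace: "u \<ge> 0 \<Longrightarrow> (LBINT x:{0<..}. exp (- u * x) * g x t) = exp (- t * u powr \<alpha>)"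
  using assms unfolding stable_density_def by auto

text \<open>\<open>stable_density\<close> constrains each time separately; what ties the times
  together is that the Laplace transform determines a continuous density. Rescaling space by
  \<open>s\<close> turns \<open>u\<close> into \<open>u / s\<close>, and
  \<open>s powr \<alpha> = 1 / y\<close> produces the factor \<open>y\<close> in the
  exponent.\<close>

lemma stable_density_scaling:
  assumes g: "stable_density \<alpha> g" and \<alpha>: "\<alpha> > 0" and y: "y > 0" and x: "x > 0"
  shows "g x y = y powr (- 1 / \<alpha>) * g (y powr (- 1 / \<alpha>) * x) 1"
proof -
  define s where "s = y powr (- 1 / \<alpha>)"
  have s: "s > 0" using y by (simp add: s_def)
  note g1 = stable_density_continuous[OF g, of 1] and gy = stable_density_continuous[OF g y]
  have scaled: "set_integrable lborel {0<..} (\<lambda>x. exp (- u * x) * (s * g (s * x) 1)) \<and>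
      (LBINT x:{0<..}. exp (- u * x) * (s * g (s * x) 1)) = exp (- y * u powr \<alpha>)" if u: "u \<ge> 0" for u
  proof -
    define k where "k z = indicator {0<..} z *\<^sub>R (exp (- (u / s) * z) * g z 1)" for z
    have k: "s * k (0 + s * x) = indicator {0<..} x *\<^sub>R (exp (- u * x) * (s * g (s * x) 1))" for x
      using s by (auto simp: k_def indicator_def zero_less_mult_iff)
    have us: "u / s \<ge> 0" using u s by simp
    have int_k: "integrable lborel k"
      using stable_density_integrable[OF g _ us, of 1] by (simp add: set_integrable_def k_def[abs_def])
    then have "integrable lborel (\<lambda>x. s * k (0 + s * x))"
      using s lborel_integrable_real_affine_iff[of s k 0] by simp
    moreover have "(LBINT x. s * k (0 + s * x)) = (LBINT z. k z)"
      using lborel_integral_real_affine[of s k 0] s by simp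
    moreover have "(LBINT z. k z) = exp (- ((u / s) powr \<alpha>))"
      using stable_density_Laplace[OF g _ us, of 1] by (simp add: set_lebesgue_integral_def k_def)
    moreover have "(u / s) powr \<alpha> = y * u powr \<alpha>"
    proof -
      have "s powr \<alpha> = y powr (- 1)" unfolding s_def powr_powr using \<alpha> by simp
      also have "\<dots> = 1 / y" using y by (simp add: powr_minus_divide)
      finally have "s powr \<alpha> = 1 / y" .
      then show ?thesis using u s by (simp add: powr_divide)
    qed
    ultimately show ?thesis unfolding k by (simp add: set_integrable_def set_lebesgue_integral_def)
  qed
  define h where "h x = g x y - s * g (s * x) 1" for x
  have "h x = 0"
  proof (rule Laplace_transform_zero_imp_zero[OF _ _ _ x])
    show "continuous_on {0<..} h"
      unfolding h_def using s
      by (intro continuous_on_diff gy continuous_on_mult continuous_on_const continuous_on_compose2[OF g1])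
         (auto intro!: continuous_intros)
    fix n :: nat
    have n: "real n \<ge> 0" by simp
    note ints = stable_density_integrable[OF g y n] scaled[OF n, THEN conjunct1]
    show "set_integrable lborel {0<..} (\<lambda>x. exp (- real n * x) * h x)"
      using set_integral_diff(1)[OF ints] by (simp add: h_def right_diff_distrib)
    show "(LBINT x:{0<..}. exp (- real n * x) * h x) = 0"
      using set_integral_diff(2)[OF ints] stable_density_Laplace[OF g y n] scaled[OF n, THEN conjunct2]
      by (simp add: h_def right_diff_distrib)
  qed
  then show ?thesis by (simp add: h_def s_def)
qed

section \<open>Moments of the stable law at time 1\<close>

text \<open>The index may vary with the point without any measurable choice: each term lies below
  the whole sum, whose integral is finite by monotone convergence.\<close>

lemma set_integrable_dominated_by_series_term:
  fixes f :: "'a \<Rightarrow> real" and F :: "nat \<Rightarrow> 'a \<Rightarrow> real"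
  assumes meas: "set_borel_measurable M A f"
    and int: "\<And>n. set_integrable M A (F n)"
    and nonneg: "\<And>n x. x \<in> A \<Longrightarrow> 0 \<le> F n x"
    and summ: "summable (\<lambda>n. LINT x:A|M. F n x)"
    and dom: "\<And>x. x \<in> A \<Longrightarrow> \<exists>n. \<bar>f x\<bar> \<le> F n x"
  shows "set_integrable M A f"
  unfolding set_integrable_def
proof (rule integrableI_bounded)
  define G where "G n x = indicator A x *\<^sub>R F n x" for n x
  have G: "integrable M (G n)" "G n x \<ge> 0" for n x
    using int[of n] nonneg[of x n] by (auto simp: set_integrable_def G_def[abs_def] indicator_def)
  show "(\<lambda>x. indicat_real A x *\<^sub>R f x) \<in> borel_measurable M"
    using meas by (simp add: set_borel_measurable_def)
  have "(\<integral>\<^sup>+x. ennreal (norm (indicat_real A x *\<^sub>R f x)) \<partial>M) \<le> (\<integral>\<^sup>+x. (\<Sum>n. ennreal (G n x)) \<partial>M)"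
  proof (rule nn_integral_mono)
    fix x
    show "ennreal (norm (indicat_real A x *\<^sub>R f x)) \<le> (\<Sum>n. ennreal (G n x))"
    proof (cases "x \<in> A")
      case True
      then obtain n where "\<bar>f x\<bar> \<le> F n x" using dom by blast
      then have "ennreal (norm (indicat_real A x *\<^sub>R f x)) \<le> (\<Sum>i\<in>{n}. ennreal (G i x))"
        using True by (simp add: G_def ennreal_leI)
      also have "\<dots> \<le> (\<Sum>n. ennreal (G n x))" by (rule sum_le_suminf) auto
      finally show ?thesis .
    qed simp
  qed
  also have "\<dots> = (\<Sum>n. \<integral>\<^sup>+x. ennreal (G n x) \<partial>M)"
    using G(1) by (intro nn_integral_suminf) auto
  also have "\<dots> = (\<Sum>n. ennreal (LINT x|M. G n x))"
    using G by (intro suminf_cong nn_integral_eq_integral) auto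
  also have "\<dots> = ennreal (\<Sum>n. LINT x|M. G n x)"
    using summ G by (intro suminf_ennreal2) (auto simp: set_lebesgue_integral_def G_def)
  finally show "(\<integral>\<^sup>+x. ennreal (norm (indicat_real A x *\<^sub>R f x)) \<partial>M) < \<infinity>"
    by (simp add: order_le_less_trans)
qed

text \<open>Only the Laplace transform of the stable law is known, so moments are bounded by dominating the
  integrand at each point by a single term of a series of Laplace kernels: here the term with
  \<open>n\<close> about \<open>A / z\<close>, in the next lemma the one with \<open>2 ^ n\<close> about \<open>z\<close>.\<close>

lemma stable_density_exp_moment:
  assumes g: "stable_density \<alpha> g" and \<alpha>: "\<alpha> > 0"
  shows "set_integrable lborel {0<..} (\<lambda>z. exp (K * z powr (- \<alpha>)) * g z 1)"
proof (rule set_integrable_dominated_by_series_term)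
  \<comment> \<open>\<open>A\<close> makes \<open>(A / z) powr \<alpha>\<close> equal to
    \<open>(2 * \<bar>K\<bar> + 1) * z powr (- \<alpha>)\<close>. The Laplace transform gives
    \<open>exp (- (n powr \<alpha>))\<close>: half of this exponent pays for the exponential moment,
    the other half for summability.\<close>
  define A where "A = (2 * \<bar>K\<bar> + 1) powr (1 / \<alpha>)"
  have A: "A > 0" by (simp add: A_def)
  have A\<alpha>: "A powr \<alpha> = 2 * \<bar>K\<bar> + 1" using \<alpha> by (simp add: A_def powr_powr)
  \<comment> \<open>The first entry compensates \<open>exp (- n * z)\<close> for
    \<open>z < A\<close>, where \<open>n * z \<le> 2 * A\<close>; the second serves
    \<open>z \<ge> A\<close> with \<open>n = 0\<close>.\<close>
  define C where "C = max (exp (2 * A)) (exp (\<bar>K\<bar> * A powr (- \<alpha>)))"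
  define F where "F n z = C * exp (real n powr \<alpha> / 2) * (exp (- real n * z) * g z 1)" for n z
  note cont = stable_density_continuous[OF g, of 1] and g0 = stable_density_nonneg[OF g, of 1]
  show "set_borel_measurable lborel {0<..} (\<lambda>z. exp (K * z powr (- \<alpha>)) * g z 1)"
    by (intro set_borel_measurable_continuous continuous_intros cont) auto
  show "set_integrable lborel {0<..} (F n)" for n
    unfolding F_def using stable_density_integrable[OF g, of 1 "real n"] by simp
  have C: "C > 0" by (simp add: C_def less_max_iff_disj)
  show "0 \<le> F n z" if "z \<in> {0<..}" for n z using g0[of z] that C by (simp add: F_def)
  have "(LBINT z:{0<..}. F n z) = C * exp (- (real n powr \<alpha>) / 2)" for n
    unfolding F_def using stable_density_Laplace[OF g, of 1 "real n"] by (simp flip: exp_add)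
  moreover have "summable (\<lambda>n. C * exp (- (real n powr \<alpha>) / 2))"
  proof (intro summable_mult)
    have "(\<lambda>n. exp (- (real n powr \<alpha>) / 2)) \<in> O(\<lambda>n. real n powr (- 2))"
      using \<alpha> by real_asymp
    then show "summable (\<lambda>n. exp (- (real n powr \<alpha>) / 2))"
      by (rule summable_comparison_test_bigo[rotated]) (simp add: summable_real_powr_iff)
  qed
  ultimately show "summable (\<lambda>n. LBINT z:{0<..}. F n z)" by simp
  show "\<exists>n. \<bar>exp (K * z powr (- \<alpha>)) * g z 1\<bar> \<le> F n z" if "z \<in> {0<..}" for z
  proof -
    have z: "z > 0" "g z 1 \<ge> 0" using that g0 by auto
    have K: "exp (K * z powr (- \<alpha>)) \<le> exp (\<bar>K\<bar> * z powr (- \<alpha>))"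
      by (simp add: mult_right_mono)
    have "\<exists>n. exp (K * z powr (- \<alpha>)) \<le> C * exp (real n powr \<alpha> / 2) * exp (- real n * z)"
    proof (cases "z \<ge> A")
      case True
      then have "z powr (- \<alpha>) \<le> A powr (- \<alpha>)" using A \<alpha> by (intro powr_mono2') auto
      then have "exp (\<bar>K\<bar> * z powr (- \<alpha>)) \<le> C"
        unfolding C_def by (simp add: le_max_iff_disj mult_left_mono)
      with K have "exp (K * z powr (- \<alpha>)) \<le> C" by (rule order_trans)
      then show ?thesis by (intro exI[of _ 0]) simp
    next
      case False
      define n where "n = nat \<lceil>A / z\<rceil>"
      have n: "A / z \<le> n" "n \<le> A / z + 1"
        using divide_pos_pos[OF A z(1)] unfolding n_def by linarith+
      have "1 \<le> A / z" using False z by simp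
      with n have "real n \<le> 2 * (A / z)" by linarith
      then have "n * z \<le> 2 * (A / z) * z" using z(1) by (intro mult_right_mono) auto
      then have nz: "n * z \<le> 2 * A" using z by simp
      have "(2 * \<bar>K\<bar> + 1) * z powr (- \<alpha>) = (A / z) powr \<alpha>"
        using A z A\<alpha> by (simp add: powr_divide powr_minus divide_simps)
      also have "\<dots> \<le> real n powr \<alpha>" using n A z \<alpha> by (intro powr_mono2) auto
      finally have "(2 * \<bar>K\<bar>) * z powr (- \<alpha>) \<le> real n powr \<alpha>"
        by (rule order_trans[rotated]) (simp add: mult_right_mono)
      then have "exp (\<bar>K\<bar> * z powr (- \<alpha>)) \<le> exp (2 * A + real n powr \<alpha> / 2 - n * z)"
        using nz by simp
      also have "\<dots> = exp (2 * A) * exp (real n powr \<alpha> / 2) * exp (- real n * z)"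
        unfolding exp_add[symmetric] by simp
      also have "\<dots> \<le> C * exp (real n powr \<alpha> / 2) * exp (- real n * z)"
        by (intro mult_right_mono) (auto simp: C_def)
      finally have "exp (\<bar>K\<bar> * z powr (- \<alpha>)) \<le> C * exp (real n powr \<alpha> / 2) * exp (- real n * z)" .
      with K have "exp (K * z powr (- \<alpha>)) \<le> C * exp (real n powr \<alpha> / 2) * exp (- real n * z)"
        by (rule order_trans)
      then show ?thesis ..
    qed
    then obtain n where "exp (K * z powr (- \<alpha>)) \<le> C * exp (real n powr \<alpha> / 2) * exp (- real n * z)" ..
    then have "exp (K * z powr (- \<alpha>)) * g z 1 \<le> F n z"
      using z(2) unfolding F_def mult.assoc[symmetric] by (rule mult_right_mono)
    then show ?thesis using z(2) by (intro exI[of _ n]) simp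
  qed
qed

lemma stable_density_frac_moment:
  assumes g: "stable_density \<alpha> g" and \<alpha>: "\<alpha> > 0"
  shows "set_integrable lborel {0<..} (\<lambda>z. z powr (\<alpha> / 2) * g z 1)"
proof (rule set_integrable_dominated_by_series_term)
  \<comment> \<open>\<open>q\<close> is the growth of \<open>z powr (\<alpha> / 2)\<close> when
    \<open>z\<close> doubles. The function \<open>1 - exp (- z / 2 ^ n)\<close> has integral at most
    \<open>(1 / q) ^ (2 * n)\<close> against the density, so the weight \<open>q ^ n\<close> leaves
    a geometric series.\<close>
  define q where "q = 2 powr (\<alpha> / 2)"
  have q: "q > 1" using \<alpha> by (simp add: q_def)
  \<comment> \<open>\<open>1 - exp (- 1)\<close> bounds \<open>1 - exp (- z / 2 ^ n)\<close> from
    below once \<open>z \<ge> 2 ^ n\<close>; the extra \<open>q\<close> covers \<open>z\<close> up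
    to \<open>2 ^ (n + 1)\<close>.\<close>
  define C where "C = q / (1 - exp (- 1))"
  have C: "C > 0" using q by (simp add: C_def)
  define G where "G u z = exp (- u * z) * g z 1" for u z
  \<comment> \<open>The first summand, with \<open>n = 0\<close>, takes care of
    \<open>z \<le> 1\<close>; the second is the weighted tail for larger \<open>z\<close>.\<close>
  define F where "F n z = (1 / 2) ^ n * G 0 z + C * q ^ n * (G 0 z - G ((1 / 2) ^ n) z)" for n :: nat and z
  note cont = stable_density_continuous[OF g, of 1] and g0 = stable_density_nonneg[OF g, of 1]
  note int = stable_density_integrable[OF g, of 1] and Lap = stable_density_Laplace[OF g, of 1]
  have F_eq: "F n z = ((1 / 2) ^ n + C * q ^ n * (1 - exp (- ((1 / 2) ^ n) * z))) * g z 1" for n z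
    unfolding F_def G_def by (simp only: mult_zero_left minus_zero exp_zero mult_1_left) (simp only: ring_distribs mult_1_left mult_1_right mult_ac)
  show "set_borel_measurable lborel {0<..} (\<lambda>z. z powr (\<alpha> / 2) * g z 1)"
    by (intro set_borel_measurable_continuous continuous_intros cont) auto
  have G_int: "set_integrable lborel {0<..} (G u)" "(LBINT z:{0<..}. G u z) = exp (- (u powr \<alpha>))" if "u \<ge> 0" for u
    using int[OF _ that] Lap[OF _ that] by (auto simp: G_def[abs_def])
  have ints: "set_integrable lborel {0<..} (G 0)" "set_integrable lborel {0<..} (G ((1 / 2) ^ n))" for n :: nat
    by (auto intro: G_int)
  show "set_integrable lborel {0<..} (F n)" for n
    unfolding F_def by (intro set_integral_add(1) set_integrable_mult_right set_integral_diff(1) ints)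
  show "0 \<le> F n z" if "z \<in> {0<..}" for n z
    using g0[of z] that C q unfolding F_eq by (intro mult_nonneg_nonneg add_nonneg_nonneg) auto
  have F_int: "(LBINT z:{0<..}. F n z) = (1 / 2) ^ n + C * q ^ n * (1 - exp (- (((1 / 2) ^ n) powr \<alpha>)))" for n
  proof -
    have "(LBINT z:{0<..}. F n z) = (LBINT z:{0<..}. (1 / 2) ^ n * G 0 z) +
        (LBINT z:{0<..}. C * q ^ n * (G 0 z - G ((1 / 2) ^ n) z))"
      unfolding F_def by (rule set_integral_add(2)) (intro set_integrable_mult_right set_integral_diff(1) ints)+
    also have "\<dots> = (1 / 2) ^ n * (LBINT z:{0<..}. G 0 z) +
        C * q ^ n * ((LBINT z:{0<..}. G 0 z) - (LBINT z:{0<..}. G ((1 / 2) ^ n) z))"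
      using ints by (simp only: set_integral_mult_right set_integral_diff)
    finally show ?thesis by (simp add: G_int)
  qed
  have "norm (LBINT z:{0<..}. F n z) \<le> (1 / 2) ^ n + C * (1 / q) ^ n" for n
  proof -
    have "((1 / 2) ^ n) powr \<alpha> = ((1 / q) ^ n) * (1 / q) ^ n"
    proof -
      have "2 powr \<alpha> = q * q" unfolding q_def powr_add[symmetric] by simp
      then have half: "(1 / 2) powr \<alpha> = 1 / q * (1 / q)" by (simp add: powr_divide)
      have "(1 / 2 :: real) ^ n = (1 / 2) powr real n" by (rule powr_realpow[symmetric]) simp
      then have "((1 / 2) ^ n) powr \<alpha> = (1 / 2) powr (real n * \<alpha>)"
        by (simp only: powr_powr)
      also have "\<dots> = ((1 / 2) powr \<alpha>) ^ n" by (subst powr_power) (auto simp: mult.commute)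
      finally show ?thesis unfolding half power_mult_distrib .
    qed
    moreover have "1 - exp (- (((1 / 2) ^ n) powr \<alpha>)) \<le> ((1 / 2) ^ n) powr \<alpha>"
      using exp_ge_add_one_self[of "- (((1 / 2) ^ n) powr \<alpha>)"] by simp
    ultimately have "C * q ^ n * (1 - exp (- (((1 / 2) ^ n) powr \<alpha>))) \<le> C * q ^ n * ((1 / q) ^ n * (1 / q) ^ n)"
      using C q by (intro mult_left_mono) auto
    also have "\<dots> = C * (1 / q) ^ n" using q by (simp add: power_divide)
    finally have "C * q ^ n * (1 - exp (- (((1 / 2) ^ n) powr \<alpha>))) \<le> C * (1 / q) ^ n" .
    moreover have "0 \<le> C * q ^ n * (1 - exp (- (((1 / 2) ^ n) powr \<alpha>)))" using C q by simp
    ultimately show ?thesis unfolding F_int by simp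
  qed
  then have "norm (LBINT z:{0<..}. F n z) \<le> (1 / 2) ^ n + C * (1 / q) ^ n" if "n \<ge> 0" for n .
  moreover have "summable (\<lambda>n. (1 / 2) ^ n + C * (1 / q) ^ n)"
    using q by (intro summable_add summable_mult summable_geometric) auto
  ultimately show "summable (\<lambda>n. LBINT z:{0<..}. F n z)"
    by (rule summable_comparison_test'[where N = 0, rotated])
  show "\<exists>n. \<bar>z powr (\<alpha> / 2) * g z 1\<bar> \<le> F n z" if "z \<in> {0<..}" for z
  proof -
    have z: "z > 0" "g z 1 \<ge> 0" using that g0 by auto
    have "\<exists>n. z powr (\<alpha> / 2) \<le> (1 / 2) ^ n + C * q ^ n * (1 - exp (- ((1 / 2) ^ n) * z))"
    proof (cases "z \<le> 1")
      case True
      then have "z powr (\<alpha> / 2) \<le> 1" using z \<alpha> by (intro powr_le1) auto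
      also have "1 \<le> 1 + C * (1 - exp (- z))" using C z by simp
      finally show ?thesis by (intro exI[of _ 0]) simp
    next
      case False
      define n where "n = nat \<lfloor>log 2 z\<rfloor>"
      have "log 2 z > 0" using False by simp
      then have "real n \<le> log 2 z" "log 2 z < real n + 1" unfolding n_def by linarith+
      then have n: "2 powr real n \<le> z" "z \<le> 2 powr (real n + 1)"
        using z by (auto simp: le_log_iff log_less_iff)
      have "exp (- ((1 / 2) ^ n) * z) \<le> exp (- 1)"
        using n(1) by (simp add: powr_realpow power_divide)
      then have "(1 - exp (- 1)) \<le> 1 - exp (- ((1 / 2) ^ n) * z)" by simp
      then have "C * q ^ n * (1 - exp (- 1)) \<le> C * q ^ n * (1 - exp (- ((1 / 2) ^ n) * z))"
        using C q by (intro mult_left_mono) auto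
      moreover have "C * q ^ n * (1 - exp (- 1)) = q * q ^ n" by (simp add: C_def)
      moreover have "z powr (\<alpha> / 2) \<le> (2 powr (real n + 1)) powr (\<alpha> / 2)"
        using n z \<alpha> by (intro powr_mono2) auto
      moreover have "(2 powr (real n + 1)) powr (\<alpha> / 2) = q * q ^ n"
      proof -
        have "q ^ n = 2 powr (\<alpha> / 2 * real n)"
          unfolding q_def by (subst powr_power) (auto simp: mult.commute)
        moreover have "(real n + 1) * (\<alpha> / 2) = \<alpha> / 2 + \<alpha> / 2 * real n" by (simp add: algebra_simps)
        ultimately show ?thesis unfolding powr_powr by (simp only: powr_add q_def)
      qed
      ultimately have "z powr (\<alpha> / 2) \<le> C * q ^ n * (1 - exp (- ((1 / 2) ^ n) * z))" by linarith
      also have "\<dots> \<le> (1 / 2) ^ n + \<dots>" by simp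
      finally show ?thesis ..
    qed
    then obtain n where "z powr (\<alpha> / 2) \<le> (1 / 2) ^ n + C * q ^ n * (1 - exp (- ((1 / 2) ^ n) * z))" ..
    then have "z powr (\<alpha> / 2) * g z 1 \<le> F n z"
      using z(2) unfolding F_eq by (rule mult_right_mono)
    then show ?thesis using z(2) by (intro exI[of _ n]) simp
  qed
qed

text \<open>For \<open>v = z powr (- \<alpha>)\<close> at most 1 the exponential is bounded and
  \<open>v powr s\<close> is at most \<open>z powr (\<alpha> / 2)\<close>; for larger
  \<open>v\<close> the power is absorbed by raising the exponential rate, as
  \<open>ln v \<le> v\<close>.\<close>

lemma stable_density_moment:
  assumes g: "stable_density \<alpha> g" and \<alpha>: "\<alpha> > 0" and s: "s > - 1 / 2"
  shows "set_integrable lborel {0<..} (\<lambda>z. exp (K * z powr (- \<alpha>)) * (z powr (- \<alpha>)) powr s * g z 1)"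
proof (rule set_integrable_bound)
  let ?B = "\<lambda>z. exp \<bar>K\<bar> * (z powr (\<alpha> / 2) * g z 1) + exp ((\<bar>K\<bar> + \<bar>s\<bar>) * z powr (- \<alpha>)) * g z 1"
  note cont = stable_density_continuous[OF g, of 1] and g0 = stable_density_nonneg[OF g, of 1]
  show "set_integrable lborel {0<..} ?B"
    by (intro set_integral_add set_integrable_mult_right stable_density_frac_moment[OF g \<alpha>]
        stable_density_exp_moment[OF g \<alpha>] impI)
  show "set_borel_measurable lborel {0<..} (\<lambda>z. exp (K * z powr (- \<alpha>)) * (z powr (- \<alpha>)) powr s * g z 1)"
    by (intro set_borel_measurable_continuous continuous_intros cont) auto
  have "\<bar>exp (K * z powr (- \<alpha>)) * (z powr (- \<alpha>)) powr s * g z 1\<bar> \<le> ?B z" if z: "z > 0" for z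
  proof -
    define v where "v = z powr (- \<alpha>)"
    have v: "v > 0" using z by (simp add: v_def)
    have "exp (K * v) * v powr s \<le> exp \<bar>K\<bar> * z powr (\<alpha> / 2) + exp ((\<bar>K\<bar> + \<bar>s\<bar>) * v)"
    proof (cases "v \<le> 1")
      case True
      have "K * v \<le> \<bar>K\<bar> * 1" using v True by (intro mult_mono) auto
      moreover have "v powr s \<le> v powr (- 1 / 2)" using True v s by (intro powr_mono') auto
      moreover have "v powr (- 1 / 2) = z powr (\<alpha> / 2)" unfolding v_def powr_powr by simp
      ultimately have "exp (K * v) * v powr s \<le> exp \<bar>K\<bar> * z powr (\<alpha> / 2)"
        by (intro mult_mono) auto
      moreover have "0 \<le> exp ((\<bar>K\<bar> + \<bar>s\<bar>) * v)" by simp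
      ultimately show ?thesis by linarith
    next
      case False
      have "s * ln v \<le> \<bar>s\<bar> * v" using False v ln_le_minus_one[of v] by (intro mult_mono) auto
      moreover have "K * v \<le> \<bar>K\<bar> * v" using v by (intro mult_right_mono) auto
      ultimately have "exp (K * v + s * ln v) \<le> exp ((\<bar>K\<bar> + \<bar>s\<bar>) * v)" by (simp add: algebra_simps)
      then have "exp (K * v) * v powr s \<le> exp ((\<bar>K\<bar> + \<bar>s\<bar>) * v)"
        using v by (simp add: powr_def exp_add)
      moreover have "0 \<le> exp \<bar>K\<bar> * z powr (\<alpha> / 2)" by simp
      ultimately show ?thesis by linarith
    qed
    moreover have "g z 1 \<ge> 0" using g0[OF _ z] by simp
    ultimately have "exp (K * v) * v powr s * g z 1 \<le>
        (exp \<bar>K\<bar> * z powr (\<alpha> / 2) + exp ((\<bar>K\<bar> + \<bar>s\<bar>) * v)) * g z 1"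
      by (rule mult_right_mono)
    moreover have "\<bar>exp (K * v) * v powr s * g z 1\<bar> = exp (K * v) * v powr s * g z 1"
      using \<open>g z 1 \<ge> 0\<close> by simp
    ultimately show ?thesis by (simp add: v_def distrib_right mult.assoc)
  qed
  note bound = order_trans[OF this abs_ge_self]
  show "AE z in lborel. z \<in> {0<..} \<longrightarrow>
      norm (exp (K * z powr (- \<alpha>)) * (z powr (- \<alpha>)) powr s * g z 1) \<le> norm (?B z)"
    unfolding real_norm_def greaterThan_iff by (intro AE_I2 impI bound)
qed

section \<open>The stable density as a function of time\<close>

lemma stable_density_continuous_in_time:
  assumes g: "stable_density \<alpha> g" and \<alpha>: "\<alpha> > 0" and x: "x > 0"
  shows "continuous_on {0<..} (\<lambda>y. g x y)"
proof -
  have "continuous_on {0<..} (\<lambda>y. y powr (- 1 / \<alpha>) * g (y powr (- 1 / \<alpha>) * x) 1)"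
    using x by (intro continuous_on_mult continuous_on_compose2[OF stable_density_continuous[OF g, of 1]])
      (auto intro!: continuous_intros)
  then show ?thesis
    by (rule continuous_on_eq) (simp only: greaterThan_iff stable_density_scaling[OF g \<alpha> _ x, symmetric])
qed

text \<open>By self-similarity, the substitution \<open>z = y powr (- 1 / \<alpha>) * x\<close>
  turns an integral over time at fixed \<open>x\<close> into a spatial moment at time 1, with
  exponential rate \<open>c * x powr \<alpha>\<close>.\<close>

lemma stable_density_time_moment:
  assumes g: "stable_density \<alpha> g" and \<alpha>: "\<alpha> > 0" and x: "x > 0" and s: "s > - 1 / 2"
  shows "set_integrable lborel {0<..} (\<lambda>y. exp (c * y) * y powr (s - 1) * g x y)"
proof -
  define \<phi> where "\<phi> y = y powr (- 1 / \<alpha>) * x" for y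
  define \<phi>' where "\<phi>' y = - 1 / \<alpha> * y powr (- 1 / \<alpha> - 1) * x" for y
  define f where "f z = exp (c * x powr \<alpha> * z powr (- \<alpha>)) * (z powr (- \<alpha>)) powr s * g z 1" for z
  have e: "- 1 / \<alpha> * - \<alpha> = 1" "- \<alpha> * (- 1 / \<alpha>) = 1" using \<alpha> by auto
  have \<phi>_pow: "\<phi> y powr (- \<alpha>) = y * x powr (- \<alpha>)" if "y > 0" for y
  proof -
    have "\<phi> y powr (- \<alpha>) = (y powr (- 1 / \<alpha>)) powr (- \<alpha>) * x powr (- \<alpha>)"
      unfolding \<phi>_def by (subst powr_mult) (use that x in simp_all)
    also have "(y powr (- 1 / \<alpha>)) powr (- \<alpha>) = y" unfolding powr_powr e using that by simp
    finally show ?thesis .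
  qed
  have inj: "inj_on \<phi> {0<..}"
  proof (rule inj_onI)
    fix y y' assume y: "y \<in> {0<..}" "y' \<in> {0<..}" and eq: "\<phi> y = \<phi> y'"
    have "y * x powr (- \<alpha>) = \<phi> y powr (- \<alpha>)" using y by (intro \<phi>_pow[symmetric]) simp
    also have "\<dots> = y' * x powr (- \<alpha>)" unfolding eq using y by (intro \<phi>_pow) simp
    finally show "y = y'" using x by (simp only: mult_cancel_right powr_eq_0_iff) simp
  qed
  have image: "\<phi> ` {0<..} = {0<..}"
  proof (intro equalityI subsetI)
    fix z :: real assume z: "z \<in> {0<..}"
    have "\<phi> ((z / x) powr (- \<alpha>)) = z" unfolding \<phi>_def powr_powr e using z x by simp
    then show "z \<in> \<phi> ` {0<..}" using z x by (intro image_eqI[of _ _ "(z / x) powr (- \<alpha>)"]) auto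
  qed (use x in \<open>auto simp: \<phi>_def\<close>)
  have der: "(\<phi> has_field_derivative \<phi>' y) (at y within {0<..})" if "y \<in> {0<..}" for y
    unfolding \<phi>_def \<phi>'_def
    by (rule has_field_derivative_at_within[OF DERIV_cmult_right[OF has_real_derivative_powr]])
       (use that in auto)
  have f: "integrable lborel (\<lambda>z. indicator {0<..} z *\<^sub>R f z)"
    using stable_density_moment[OF g \<alpha> s, of "c * x powr \<alpha>"] by (simp add: f_def set_integrable_def)
  \<comment> \<open>The change of variables is carried out for the completed measure; Borel
    measurability of the result leads back to \<open>lborel\<close> at the end.\<close>
  have "f absolutely_integrable_on \<phi> ` {0<..}"
    unfolding image set_integrable_def by (rule integrable_completion[THEN iffD2, OF borel_measurable_integrable[OF f] f])
  then have "(\<lambda>y. \<bar>\<phi>' y\<bar> *\<^sub>R f (\<phi> y)) absolutely_integrable_on {0<..}"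
    by (subst (asm) absolutely_integrable_change_of_variables_real[OF _ der inj]) auto
  \<comment> \<open>This constant cancels the Jacobian factor and the powers of \<open>x\<close>
    that the substitution leaves behind.\<close>
  then have "(\<lambda>y. (\<alpha> * x powr (\<alpha> * s - 1)) *\<^sub>R (\<bar>\<phi>' y\<bar> *\<^sub>R f (\<phi> y))) absolutely_integrable_on {0<..}"
    by (intro absolutely_integrable_scaleR_left)
  moreover have "(\<alpha> * x powr (\<alpha> * s - 1)) *\<^sub>R (\<bar>\<phi>' y\<bar> *\<^sub>R f (\<phi> y)) = exp (c * y) * y powr (s - 1) * g x y"
    if "y \<in> {0<..}" for y
  proof -
    have y: "y > 0" using that by simp
    have "c * x powr \<alpha> * (y * x powr (- \<alpha>)) = c * y" using x by (simp add: powr_minus)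
    then have 1: "f (\<phi> y) = exp (c * y) * (y * x powr (- \<alpha>)) powr s * g (\<phi> y) 1"
      unfolding f_def \<phi>_pow[OF y] by (simp only:)
    have 2: "(y * x powr (- \<alpha>)) powr s = y powr s * x powr (- \<alpha> * s)"
      using x y by (simp add: powr_mult powr_powr)
    have 3: "\<bar>\<phi>' y\<bar> = x * y powr (- 1 / \<alpha> - 1) / \<alpha>"
      unfolding \<phi>'_def using x \<alpha> by (simp add: abs_mult)
    have 4: "g x y = y powr (- 1 / \<alpha>) * g (\<phi> y) 1"
      unfolding \<phi>_def by (rule stable_density_scaling[OF g \<alpha> y x])
    have 5: "x powr (\<alpha> * s - 1) * x * x powr (- \<alpha> * s) = 1"
    proof -
      have "x powr (\<alpha> * s - 1) * x powr 1 * x powr (- \<alpha> * s) = x powr 0"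
        unfolding powr_add[symmetric] by simp
      then show ?thesis using x by simp
    qed
    have 6: "y powr (- 1 / \<alpha> - 1) * y powr s = y powr (s - 1) * y powr (- 1 / \<alpha>)"
      unfolding powr_add[symmetric] by (rule arg_cong[where f = "(powr) y"]) simp
    have regroup: "(\<alpha> * A) * (x * B / \<alpha> * (E * (Y * X) * G)) = (A * x * X) * E * (B * Y) * G"
      for A B E X Y G using \<alpha> by simp
    have "(\<alpha> * x powr (\<alpha> * s - 1)) *\<^sub>R (\<bar>\<phi>' y\<bar> *\<^sub>R f (\<phi> y)) =
        (x powr (\<alpha> * s - 1) * x * x powr (- \<alpha> * s)) * exp (c * y) *
        (y powr (- 1 / \<alpha> - 1) * y powr s) * g (\<phi> y) 1"
      unfolding 1 2 3 real_scaleR_def by (rule regroup)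
    also have "\<dots> = exp (c * y) * y powr (s - 1) * g x y"
      unfolding 4 5 6 by (simp only: mult_1_left mult.assoc)
    finally show ?thesis .
  qed
  ultimately have "(\<lambda>y. exp (c * y) * y powr (s - 1) * g x y) absolutely_integrable_on {0<..}"
    by (rule iffD1[OF set_integrable_cong[OF refl refl], rotated])
  moreover have "set_borel_measurable lborel {0<..} (\<lambda>y. exp (c * y) * y powr (s - 1) * g x y)"
    by (intro set_borel_measurable_continuous continuous_intros stable_density_continuous_in_time[OF g \<alpha> x]) auto
  ultimately show ?thesis
    unfolding set_integrable_def set_borel_measurable_def by (subst (asm) integrable_completion) auto
qed

section \<open>Mellin transforms\<close>

text \<open>The kernel is written with \<open>exp\<close> and the real logarithm, so that it is
  entire in \<open>z\<close> for each \<open>y > 0\<close> and its derivative just brings down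
  \<open>ln y\<close>.\<close>

definition Mellin :: "(real \<Rightarrow> real) \<Rightarrow> complex \<Rightarrow> complex" where
  "Mellin W z = (LBINT y:{0<..}. of_real (W y) * exp ((z - 1) * of_real (ln y)))"

lemma Mellin_of_real: "Mellin W (of_real s) = of_real (LBINT y:{0<..}. W y * y powr (s - 1))"
proof -
  have "indicator {0<..} y *\<^sub>R (of_real (W y) * exp ((of_real s - 1) * of_real (ln y))) =
      complex_of_real (indicator {0<..} y *\<^sub>R (W y * y powr (s - 1)))" for y
    by (simp add: indicator_def powr_def exp_of_real[symmetric])
  then show ?thesis
    unfolding Mellin_def set_lebesgue_integral_def by (simp only: integral_complex_of_real)
qed

text \<open>With \<open>L = ln y\<close> this dominates the logarithm times all powers with
  exponents near \<open>s\<close> by two fixed powers: the logarithm costs one \<open>r\<close>, the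
  variation of the exponent another, and the sign of \<open>L\<close> decides which power is the
  larger.\<close>

lemma abs_mult_exp_le:
  fixes L :: real
  assumes r: "r > 0" and "\<bar>s' - s\<bar> \<le> r"
  shows "\<bar>L\<bar> * exp (s' * L) \<le> (exp ((s + 2 * r) * L) + exp ((s - 2 * r) * L)) / r"
proof -
  have "r * \<bar>L\<bar> \<le> exp (r * \<bar>L\<bar>)" using exp_ge_add_one_self[of "r * \<bar>L\<bar>"] by linarith
  then have L: "\<bar>L\<bar> \<le> exp (r * \<bar>L\<bar>) / r" using r by (simp add: field_simps)
  have "(s' - s) * L \<le> \<bar>s' - s\<bar> * \<bar>L\<bar>" by (metis abs_ge_self abs_mult)
  also have "\<dots> \<le> r * \<bar>L\<bar>" using assms by (intro mult_right_mono) auto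
  finally have "s' * L \<le> s * L + r * \<bar>L\<bar>" by (simp add: algebra_simps)
  then have "\<bar>L\<bar> * exp (s' * L) \<le> exp (r * \<bar>L\<bar>) / r * exp (s * L + r * \<bar>L\<bar>)"
    using r by (intro mult_mono L) auto
  also have "\<dots> = exp (s * L + 2 * r * \<bar>L\<bar>) / r"
    by (simp add: exp_add[symmetric] algebra_simps)
  also have "\<dots> \<le> (exp ((s + 2 * r) * L) + exp ((s - 2 * r) * L)) / r"
  proof (cases "L \<ge> 0")
    case True
    then have "exp (s * L + 2 * r * \<bar>L\<bar>) = exp ((s + 2 * r) * L)" by (simp add: algebra_simps)
    then show ?thesis using r by (simp add: divide_right_mono)
  next
    case False
    then have "exp (s * L + 2 * r * \<bar>L\<bar>) = exp ((s - 2 * r) * L)" by (simp add: algebra_simps)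
    then show ?thesis using r by (simp add: divide_right_mono)
  qed
  finally show ?thesis .
qed

context
  fixes W :: "real \<Rightarrow> real" and s0 :: real
  assumes W_cont: "continuous_on {0<..} W"
    and W_int: "\<And>s. s > s0 \<Longrightarrow> set_integrable lborel {0<..} (\<lambda>y. W y * y powr (s - 1))"
begin

lemma
  assumes z: "Re z0 > s0"
  shows Mellin_derivative_integrable:
      "set_integrable lborel {0<..} (\<lambda>y. of_real (W y) * (of_real (ln y) * exp ((z0 - 1) * of_real (ln y))))"
    and has_field_derivative_Mellin:
      "(Mellin W has_field_derivative
        (LBINT y:{0<..}. of_real (W y) * (of_real (ln y) * exp ((z0 - 1) * of_real (ln y))))) (at z0)"
proof -
  \<comment> \<open>A third of the distance to the boundary, so that the dominating exponent
    \<open>Re z0 - 2 * r\<close> still lies in the region of convergence.\<close>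
  define r where "r = (Re z0 - s0) / 3"
  have r: "r > 0" "Re z0 - 2 * r > s0" "Re z0 - r > s0" "Re z0 + 2 * r > s0"
    using z by (auto simp: r_def field_simps)
  let ?f = "\<lambda>z y. indicator {0<..} y *\<^sub>R (of_real (W y) * exp ((z - 1) * of_real (ln y)) :: complex)"
  let ?f' = "\<lambda>z y. indicator {0<..} y *\<^sub>R (of_real (W y) * (of_real (ln y) * exp ((z - 1) * of_real (ln y))) :: complex)"
  let ?B = "\<lambda>y. indicator {0<..} y *\<^sub>R
    (1 / r * (\<bar>W y * y powr (Re z0 + 2 * r - 1)\<bar> + \<bar>W y * y powr (Re z0 - 2 * r - 1)\<bar>))"
  have f: "integrable lborel (?f z)" if "z \<in> ball z0 r" for z
  proof -
    have "\<bar>Re z - Re z0\<bar> < r" using that abs_Re_le_cmod[of "z - z0"] by (simp add: dist_norm norm_minus_commute)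
    then have s: "Re z > s0" using r by linarith
    have "set_integrable lborel {0<..} (\<lambda>y. of_real (W y) * exp ((z - 1) * of_real (ln y)))"
    proof (rule set_integrable_bound[OF W_int[OF s]])
      show "set_borel_measurable lborel {0<..} (\<lambda>y. of_real (W y) * exp ((z - 1) * of_real (ln y)))"
        by (intro set_borel_measurable_continuous continuous_intros W_cont) auto
      show "AE y in lborel. y \<in> {0<..} \<longrightarrow>
          norm (of_real (W y) * exp ((z - 1) * of_real (ln y))) \<le> norm (W y * y powr (Re z - 1))"
        by (intro AE_I2) (auto simp: norm_mult powr_def abs_mult)
    qed
    then show ?thesis by (simp add: set_integrable_def)
  qed
  have der: "((\<lambda>z. ?f z y) has_field_derivative ?f' z y) (at z)" for z y
    by (auto intro!: derivative_eq_intros simp: scaleR_conv_of_real)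
  have bound: "norm (?f' z y) \<le> ?B y" if "z \<in> ball z0 r" for z y
  proof (cases "y \<in> {0<..}")
    case True
    have "\<bar>Re z - Re z0\<bar> \<le> r" using that abs_Re_le_cmod[of "z - z0"] by (simp add: dist_norm norm_minus_commute)
    then have "\<bar>ln y\<bar> * exp ((Re z - 1) * ln y) \<le>
        (exp ((Re z0 - 1 + 2 * r) * ln y) + exp ((Re z0 - 1 - 2 * r) * ln y)) / r"
      using r by (intro abs_mult_exp_le) auto
    also have "\<dots> = 1 / r * (y powr (Re z0 + 2 * r - 1) + y powr (Re z0 - 2 * r - 1))"
      using True by (simp add: powr_def algebra_simps add_divide_distrib)
    finally have "\<bar>W y\<bar> * (\<bar>ln y\<bar> * exp ((Re z - 1) * ln y)) \<le>
        \<bar>W y\<bar> * (1 / r * (y powr (Re z0 + 2 * r - 1) + y powr (Re z0 - 2 * r - 1)))"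
      by (rule mult_left_mono) simp
    then show ?thesis using True by (simp add: norm_mult abs_mult algebra_simps)
  qed simp
  have B: "integrable lborel ?B"
    using set_integrable_mult_right[of "1 / r",
        OF set_integral_add(1)[OF set_integrable_abs[OF W_int[OF r(4)]] set_integrable_abs[OF W_int[OF r(2)]]]]
    by (simp add: set_integrable_def)
  show "set_integrable lborel {0<..} (\<lambda>y. of_real (W y) * (of_real (ln y) * exp ((z0 - 1) * of_real (ln y))))"
    unfolding set_integrable_def
    by (rule integrable_derivative_dominated[OF r(1) f der bound B])
  show "(Mellin W has_field_derivative
      (LBINT y:{0<..}. of_real (W y) * (of_real (ln y) * exp ((z0 - 1) * of_real (ln y))))) (at z0)"
    unfolding Mellin_def[abs_def] set_lebesgue_integral_def
    by (rule has_field_derivative_integral_dominated[OF r(1) f der bound B])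
qed

lemma Mellin_holomorphic: "Mellin W holomorphic_on {z. s0 < Re z}"
  using has_field_derivative_Mellin by (auto simp: holomorphic_on_open open_halfspace_Re_gt)

lemma
  assumes s: "s > s0"
  shows Mellin_ln_integrable: "set_integrable lborel {0<..} (\<lambda>y. W y * (ln y * y powr (s - 1)))"
    and has_real_derivative_Mellin:
      "((\<lambda>s. LBINT y:{0<..}. W y * y powr (s - 1)) has_real_derivative
        (LBINT y:{0<..}. W y * (ln y * y powr (s - 1)))) (at s)"
proof -
  have s': "Re (of_real s) > s0" using s by simp
  have eq: "indicator {0<..} y *\<^sub>R (of_real (W y) * (of_real (ln y) * exp ((of_real s - 1) * of_real (ln y)))) =
      complex_of_real (indicator {0<..} y *\<^sub>R (W y * (ln y * y powr (s - 1))))" for y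
    by (simp add: indicator_def powr_def exp_of_real[symmetric])
  show "set_integrable lborel {0<..} (\<lambda>y. W y * (ln y * y powr (s - 1)))"
    using Mellin_derivative_integrable[OF s'] unfolding set_integrable_def eq
    by (simp only: complex_of_real_integrable_eq)
  have "deriv (Mellin W) (of_real s) = of_real (LBINT y:{0<..}. W y * (ln y * y powr (s - 1)))"
    using DERIV_imp_deriv[OF has_field_derivative_Mellin[OF s']]
    unfolding set_lebesgue_integral_def eq by (simp only: integral_complex_of_real)
  moreover have "((\<lambda>s. LBINT y:{0<..}. W y * y powr (s - 1)) has_real_derivative
      Re (deriv (Mellin W) (of_real s))) (at s)"
    by (rule has_real_derivative_Re[OF Mellin_holomorphic open_halfspace_Re_gt, of "{s0<..}"])
       (use s in \<open>auto simp: Mellin_of_real\<close>)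
  ultimately show "((\<lambda>s. LBINT y:{0<..}. W y * y powr (s - 1)) has_real_derivative
      (LBINT y:{0<..}. W y * (ln y * y powr (s - 1)))) (at s)" by simp
qed

end

section \<open>The density as a normalised Mellin transform\<close>

theorem theorem3p1:
  fixes \<alpha> \<mu> lam\<^sub>1 \<beta>\<^sub>1 :: real and g :: "real \<Rightarrow> real \<Rightarrow> real"
  assumes "0 < \<alpha>" "\<alpha> < 1" "\<mu> > 0" "lam\<^sub>1 > 0" "\<beta>\<^sub>1 > 0"
    and "stable_density \<alpha> g"
  shows "\<forall>\<tau>\<ge>1. \<forall>x>0.
      (\<forall>t>0. set_integrable lborel {0<..}
               (\<lambda>y. tempered_density \<alpha> \<mu> g x y * gamma_sub_density lam\<^sub>1 \<beta>\<^sub>1 y t) \<and>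
             set_integrable lborel {0<..}
               (\<lambda>y. tempered_density \<alpha> \<mu> g x y * ln y * gamma_sub_density lam\<^sub>1 \<beta>\<^sub>1 y t)) \<and>
      RL_differentiable \<tau> (tml_density \<alpha> \<beta>\<^sub>1 lam\<^sub>1 \<mu> g x) \<and>
      RL_differentiable (\<tau> - 1) (tml_bracket \<alpha> \<beta>\<^sub>1 lam\<^sub>1 \<mu> g x) \<and>
      (\<forall>t>0. RL_deriv \<tau> (tml_density \<alpha> \<beta>\<^sub>1 lam\<^sub>1 \<mu> g x) t =
             \<beta>\<^sub>1 * RL_deriv (\<tau> - 1) (tml_bracket \<alpha> \<beta>\<^sub>1 lam\<^sub>1 \<mu> g x) t) \<and>
      tml_density \<alpha> \<beta>\<^sub>1 lam\<^sub>1 \<mu> g x 0 = 0"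
proof (intro allI impI)
  fix \<tau> x :: real assume \<tau>: "\<tau> \<ge> 1" and x: "x > 0"
  note \<alpha> = assms(1) and lam = assms(4) and \<beta> = assms(5) and g = assms(6)
  \<comment> \<open>\<open>W\<close> gathers the factors of the integrand that do not involve
    \<open>t\<close>; time enters only through the exponent of \<open>y\<close> and the
    normalisation \<open>c\<close>.\<close>
  define W where "W y = exp (- \<mu> * x) * (exp ((\<mu> powr \<alpha> - lam\<^sub>1) * y) * g x y)" for y
  define m where "m s = (LBINT y:{0<..}. W y * y powr (s - 1))" for s
  define m' where "m' s = (LBINT y:{0<..}. W y * (ln y * y powr (s - 1)))" for s
  define c where "c t = lam\<^sub>1 powr (\<beta>\<^sub>1 * t) / Gamma (\<beta>\<^sub>1 * t)" for t
  have W_cont: "continuous_on {0<..} W"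
    unfolding W_def by (intro continuous_intros stable_density_continuous_in_time[OF g \<alpha> x])
  have W_int: "set_integrable lborel {0<..} (\<lambda>y. W y * y powr (s - 1))" if "s > - 1 / 2" for s
  proof -
    have "set_integrable lborel {0<..}
        (\<lambda>y. exp (- \<mu> * x) * (exp ((\<mu> powr \<alpha> - lam\<^sub>1) * y) * y powr (s - 1) * g x y))"
      by (intro set_integrable_mult_right stable_density_time_moment[OF g \<alpha> x that])
    then show ?thesis by (simp add: W_def mult_ac)
  qed
  note Mellin = Mellin_holomorphic[OF W_cont W_int] Mellin_of_real[of W]
    Mellin_ln_integrable[OF W_cont W_int] has_real_derivative_Mellin[OF W_cont W_int, folded m_def m'_def]
  have integrand: "tempered_density \<alpha> \<mu> g x y * gamma_sub_density lam\<^sub>1 \<beta>\<^sub>1 y t = c t * (W y * y powr (\<beta>\<^sub>1 * t - 1))"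
    if "t > 0" for y t
  proof -
    have "exp (- \<mu> * x + \<mu> powr \<alpha> * y) * exp (- lam\<^sub>1 * y) = exp (- \<mu> * x) * exp ((\<mu> powr \<alpha> - lam\<^sub>1) * y)"
      unfolding exp_add[symmetric] by (simp add: algebra_simps)
    then show ?thesis using that
      by (simp add: tempered_density_def gamma_sub_density_def c_def W_def)
  qed
  have integrand_ln: "tempered_density \<alpha> \<mu> g x y * ln y * gamma_sub_density lam\<^sub>1 \<beta>\<^sub>1 y t =
      c t * (W y * (ln y * y powr (\<beta>\<^sub>1 * t - 1)))" if "t > 0" for y t
    using integrand[OF that, of y] by (simp add: mult_ac)
  have pos: "\<beta>\<^sub>1 * t > - 1 / 2" if "t > 0" for t
    using mult_pos_pos[OF \<beta> that] by linarith
  have density: "tml_density \<alpha> \<beta>\<^sub>1 lam\<^sub>1 \<mu> g x t = c t * m (\<beta>\<^sub>1 * t)" if "t > 0" for t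
    unfolding tml_density_def m_def integrand[OF that] by simp
  have bracket: "tml_bracket \<alpha> \<beta>\<^sub>1 lam\<^sub>1 \<mu> g x t =
      (ln lam\<^sub>1 - Digamma (\<beta>\<^sub>1 * t)) * (c t * m (\<beta>\<^sub>1 * t)) + c t * m' (\<beta>\<^sub>1 * t)" if "t > 0" for t
    unfolding tml_bracket_def density[OF that] m'_def integrand_ln[OF that] by simp
  \<comment> \<open>The logarithmic derivative of \<open>c\<close> yields the digamma term and the
    derivative of the Mellin transform the \<open>ln y\<close> integral; both carry the chain-rule
    factor \<open>\<beta>\<^sub>1\<close>.\<close>
  have der: "(tml_density \<alpha> \<beta>\<^sub>1 lam\<^sub>1 \<mu> g x has_real_derivative
      \<beta>\<^sub>1 * tml_bracket \<alpha> \<beta>\<^sub>1 lam\<^sub>1 \<mu> g x t) (at t)" if t: "t > 0" for t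
  proof -
    have bt: "\<beta>\<^sub>1 * t > 0" using \<beta> t by simp
    then have nonpos: "\<beta>\<^sub>1 * t \<notin> \<int>\<^sub>\<le>\<^sub>0" by (auto elim!: nonpos_Ints_cases)
    have Gamma_nz: "Gamma (\<beta>\<^sub>1 * t) \<noteq> 0" using Gamma_real_pos[OF bt] by simp
    have lin: "((\<lambda>t. \<beta>\<^sub>1 * t) has_real_derivative \<beta>\<^sub>1) (at t)" by (auto intro!: derivative_eq_intros)
    have P: "((\<lambda>t. lam\<^sub>1 powr (\<beta>\<^sub>1 * t)) has_real_derivative lam\<^sub>1 powr (\<beta>\<^sub>1 * t) * ln lam\<^sub>1 * \<beta>\<^sub>1) (at t)"
      using lam by (auto intro!: derivative_eq_intros)
    have G: "((\<lambda>t. Gamma (\<beta>\<^sub>1 * t)) has_real_derivative Gamma (\<beta>\<^sub>1 * t) * Digamma (\<beta>\<^sub>1 * t) * \<beta>\<^sub>1) (at t)"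
      by (rule DERIV_chain2[where g = "\<lambda>t. \<beta>\<^sub>1 * t" and x = t, OF has_field_derivative_Gamma[OF nonpos] lin])
    have c': "(c has_real_derivative c t * (\<beta>\<^sub>1 * (ln lam\<^sub>1 - Digamma (\<beta>\<^sub>1 * t)))) (at t)"
      unfolding c_def[abs_def] using Gamma_nz
      by (intro DERIV_cong[OF DERIV_divide[OF P G Gamma_nz]]) (simp add: divide_simps algebra_simps)
    have "((\<lambda>t. m (\<beta>\<^sub>1 * t)) has_real_derivative m' (\<beta>\<^sub>1 * t) * \<beta>\<^sub>1) (at t)"
      by (rule DERIV_chain2[where g = "\<lambda>t. \<beta>\<^sub>1 * t" and x = t, OF Mellin(4)[OF _ pos[OF t]] lin])
    from DERIV_mult[OF c' this] have "((\<lambda>t. c t * m (\<beta>\<^sub>1 * t)) has_real_derivative \<beta>\<^sub>1 * tml_bracket \<alpha> \<beta>\<^sub>1 lam\<^sub>1 \<mu> g x t) (at t)"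
      by (simp add: bracket[OF t] algebra_simps)
    then show ?thesis
      by (rule has_field_derivative_transform_within_open[of _ _ _ "{0<..}"]) (use t density in auto)
  qed
  \<comment> \<open>\<open>Re z > - d\<close> is the condition that
    \<open>\<beta>\<^sub>1 * z\<close> has real part above -1/2.\<close>
  define d where "d = 1 / (2 * \<beta>\<^sub>1)"
  have d: "d > 0" using \<beta> by (simp add: d_def)
  \<comment> \<open>The reciprocal Gamma function is entire, so the formula itself makes sense at 0
    and takes the value 0 there.\<close>
  define F where "F z = exp (of_real (\<beta>\<^sub>1 * ln lam\<^sub>1) * z) * rGamma (of_real \<beta>\<^sub>1 * z) * Mellin W (of_real \<beta>\<^sub>1 * z)" for z
  have "(Mellin W \<circ> (\<lambda>z. of_real \<beta>\<^sub>1 * z)) holomorphic_on {z. - d < Re z}"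
  proof (rule holomorphic_on_compose_gen[OF _ Mellin(1)])
    have "- 1 / 2 < \<beta>\<^sub>1 * Re z" if "- d < Re z" for z
      using mult_strict_left_mono[OF that \<beta>] \<beta> by (simp add: d_def)
    then show "(\<lambda>z. of_real \<beta>\<^sub>1 * z) ` {z. - d < Re z} \<subseteq> {z. - 1 / 2 < Re z}" by auto
  qed (auto intro!: holomorphic_intros)
  then have F: "F holomorphic_on {z. - d < Re z}"
    unfolding F_def comp_def by (intro holomorphic_intros)
  have F_real: "tml_density \<alpha> \<beta>\<^sub>1 lam\<^sub>1 \<mu> g x t = Re (F (of_real t))" if "t > 0" for t
  proof -
    have "Mellin W (of_real \<beta>\<^sub>1 * of_real t) = of_real (m (\<beta>\<^sub>1 * t))"
      using Mellin(2)[of "\<beta>\<^sub>1 * t"] by (simp add: m_def)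
    moreover have "rGamma (of_real \<beta>\<^sub>1 * of_real t :: complex) = of_real (inverse (Gamma (\<beta>\<^sub>1 * t)))"
      using rGamma_complex_of_real[of "\<beta>\<^sub>1 * t"] by (simp add: rGamma_inverse_Gamma)
    moreover have "exp (of_real (\<beta>\<^sub>1 * ln lam\<^sub>1) * of_real t :: complex) = of_real (lam\<^sub>1 powr (\<beta>\<^sub>1 * t))"
      using lam by (simp add: powr_def exp_of_real[symmetric] mult_ac)
    ultimately have "F (of_real t) = of_real (c t * m (\<beta>\<^sub>1 * t))"
      unfolding F_def by (simp add: c_def divide_inverse)
    then show ?thesis by (simp add: density[OF that])
  qed
  have "F 0 = 0" by (simp add: F_def)
  note RL = RL_deriv_eq_RL_deriv_of_deriv[OF F d this F_real der _ \<tau>]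
  \<comment> \<open>This is the convention that the gamma density is 0 at time 0; it is separate
    from \<open>F 0 = 0\<close>, which concerns the extension from \<open>t > 0\<close>.\<close>
  have "tml_density \<alpha> \<beta>\<^sub>1 lam\<^sub>1 \<mu> g x 0 = 0"
    by (simp add: tml_density_def gamma_sub_density_def)
  moreover have "set_integrable lborel {0<..} (\<lambda>y. tempered_density \<alpha> \<mu> g x y * gamma_sub_density lam\<^sub>1 \<beta>\<^sub>1 y t)"
    "set_integrable lborel {0<..} (\<lambda>y. tempered_density \<alpha> \<mu> g x y * ln y * gamma_sub_density lam\<^sub>1 \<beta>\<^sub>1 y t)"
    if "t > 0" for t
    unfolding integrand[OF that] integrand_ln[OF that]
    using W_int[OF pos[OF that]] Mellin(3)[OF _ pos[OF that]] by (auto intro: set_integrable_mult_right)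
  ultimately show "(\<forall>t>0. set_integrable lborel {0<..}
               (\<lambda>y. tempered_density \<alpha> \<mu> g x y * gamma_sub_density lam\<^sub>1 \<beta>\<^sub>1 y t) \<and>
             set_integrable lborel {0<..}
               (\<lambda>y. tempered_density \<alpha> \<mu> g x y * ln y * gamma_sub_density lam\<^sub>1 \<beta>\<^sub>1 y t)) \<and>
      RL_differentiable \<tau> (tml_density \<alpha> \<beta>\<^sub>1 lam\<^sub>1 \<mu> g x) \<and>
      RL_differentiable (\<tau> - 1) (tml_bracket \<alpha> \<beta>\<^sub>1 lam\<^sub>1 \<mu> g x) \<and>
      (\<forall>t>0. RL_deriv \<tau> (tml_density \<alpha> \<beta>\<^sub>1 lam\<^sub>1 \<mu> g x) t =
             \<beta>\<^sub>1 * RL_deriv (\<tau> - 1) (tml_bracket \<alpha> \<beta>\<^sub>1 lam\<^sub>1 \<mu> g x) t) \<and>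
      tml_density \<alpha> \<beta>\<^sub>1 lam\<^sub>1 \<mu> g x 0 = 0"
    using RL \<beta> by simp
qed

end
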